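(* Let $\mathcal V\subset\mathbb R^{n_1+n_2+2}$ be a compact set such that every $h=(X,W,(s_{1,j}),(s_{2,j}))\in\mathcal V$ satisfies $X\in A$, $W\in B$, $s_{i,j}\in C$, where $A\subset(0,1)$, $B\subset\mathbb R$, $C\subset(0,\infty)$ are compact. Then for each $T>0$ there exist constants $K>0$ and $\varepsilon_0>0$ such that for all $\varepsilon\in(0,\varepsilon_0]$ and all initial conditions of the hard core piston system with $h_\varepsilon(0)\in\mathcal V$, \[ \sup_{0\le \tau\le T\wedge T_\varepsilon}\bigl|h_\varepsilon(\tau/\varepsilon)-\bar h(\tau)\bigr|\le K\varepsilon . \] That is, the supremum over such initial conditions of $\sup_{0\le\tau\le T\wedge T_\varepsilon}|h_\varepsilon(\tau/\varepsilon)-\bar h(\tau)|$ is $\mathcal O(\varepsilon)$ as $\varepsilon=M^{-1/2}\to0$.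
   Context: Hard core piston system: fix integers $n_1,n_2\ge1$ and masses $m_{1,j}>0$ ($1\le j\le n_1$), $m_{2,j}>0$ ($1\le j\le n_2$). A piston, a point particle of mass $M$ with position $X\in(0,1)$ and velocity $V=dX/dt$, moves in the unit interval $[0,1]$. To its left are $n_1$ point gas particles with positions $x_{1,j}\in[0,X]$, velocities $v_{1,j}$, masses $m_{1,j}$; to its right are $n_2$ point gas particles with positions $x_{2,j}\in[X,1]$, velocities $v_{2,j}$, masses $m_{2,j}$. Gas particles do not interact with each other; between collisions all particles move with constant velocity; gas particles collide elastically with fixed walls at $0$ and $1$ (velocity reversal) and elastically with the piston (collision of point masses $m_{i,j}$ and $M$ conserving momentum and kinetic energy). Simultaneous collisions of several gas particles with the piston are resolved as consecutive instantaneous collisions in a fixed order (left-side particles before right-side particles). Set $\varepsilon=M^{-1/2}$, $W=V/\varepsilon$ (so $dX/dt=\varepsilon W$), and $s_{i,j}=|v_{i,j}|$. The slow variables are $h=(X,W,s_{1,1},\dots,s_{1,n_1},s_{2,1},\dots,s_{2,n_2})\in\mathbb R^{n_1+n_2+2}$, and $h_\varepsilon(t)$ denotes their value at time $t$ along the motion with $M=\varepsilon^{-2}$ from a given initial condition. The averaged vector field $\bar H$ on $\mathbb R^{n_1+n_2+2}$ is \[ \frac{dX}{d\tau}=W,\quad \frac{dW}{d\tau}=\frac{\sum_{j=1}^{n_1}m_{1,j}s_{1,j}^2}{X}-\frac{\sum_{j=1}^{n_2}m_{2,j}s_{2,j}^2}{1-X},\quad \frac{ds_{1,j}}{d\tau}=-\frac{s_{1,j}W}{X},\quad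 \frac{ds_{2,j}}{d\tau}=\frac{s_{2,j}W}{1-X}, \] and $\bar h(\tau)$ denotes the solution of $d\bar h/d\tau=\bar H(\bar h)$ with $\bar h(0)=h_\varepsilon(0)$. The stopping time is $T_\varepsilon=\inf\{\tau\ge0:\bar h(\tau)\notin\mathcal V\text{ or }h_\varepsilon(\tau/\varepsilon)\notin\mathcal V\}$. *)

theory Defs
  imports "HOL-Analysis.Analysis"
begin

text \<open>Full microscopic state of the hard core piston system.
  Left gas particles are indexed by the finite type 'a (so n1 = CARD('a)),
  right gas particles by the finite type 'b (n2 = CARD('b)).
  The linear order on the index types is the fixed order in which
  simultaneous collisions on the same side are resolved.\<close>

record ('a, 'b) pstate =
  pX  :: real
  pV  :: real
  px1 :: "'a \<Rightarrow> real"
  pv1 :: "'a \<Rightarrow> real"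
  px2 :: "'b \<Rightarrow> real"
  pv2 :: "'b \<Rightarrow> real"

definition in_phase :: "('a, 'b) pstate \<Rightarrow> bool" where
  "in_phase s \<longleftrightarrow> 0 < pX s \<and> pX s < 1
     \<and> (\<forall>j. 0 \<le> px1 s j \<and> px1 s j \<le> pX s)
     \<and> (\<forall>j. pX s \<le> px2 s j \<and> px2 s j \<le> 1)"

definition flow :: "real \<Rightarrow> ('a, 'b) pstate \<Rightarrow> ('a, 'b) pstate" where
  "flow t s = s\<lparr>pX := pX s + t * pV s,
                px1 := (\<lambda>j. px1 s j + t * pv1 s j),
                px2 := (\<lambda>j. px2 s j + t * pv2 s j)\<rparr>"

text \<open>Elastic collision of a gas particle (mass m, velocity v) with the piston
  (mass M, velocity V): new velocities of the gas particle and of the piston.\<close>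
definition gas_after :: "real \<Rightarrow> real \<Rightarrow> real \<Rightarrow> real \<Rightarrow> real" where
  "gas_after m M v V = ((m - M) * v + 2 * M * V) / (m + M)"

definition piston_after :: "real \<Rightarrow> real \<Rightarrow> real \<Rightarrow> real \<Rightarrow> real" where
  "piston_after m M v V = ((M - m) * V + 2 * m * v) / (m + M)"

definition left_approaching :: "('a, 'b) pstate \<Rightarrow> 'a \<Rightarrow> bool" where
  "left_approaching s j \<longleftrightarrow> px1 s j = pX s \<and> pv1 s j > pV s"

definition right_approaching :: "('a, 'b) pstate \<Rightarrow> 'b \<Rightarrow> bool" where
  "right_approaching s j \<longleftrightarrow> px2 s j = pX s \<and> pv2 s j < pV s"

inductive coll_step ::
  "('a::linorder \<Rightarrow> real) \<Rightarrow> ('b::linorder \<Rightarrow> real) \<Rightarrow> real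
     \<Rightarrow> ('a, 'b) pstate \<Rightarrow> ('a, 'b) pstate \<Rightarrow> bool"
  for m1 m2 M where
  wall_left: "px1 s j = 0 \<Longrightarrow> pv1 s j < 0 \<Longrightarrow>
     coll_step m1 m2 M s (s\<lparr>pv1 := (pv1 s)(j := - pv1 s j)\<rparr>)"
| wall_right: "px2 s j = 1 \<Longrightarrow> pv2 s j > 0 \<Longrightarrow>
     coll_step m1 m2 M s (s\<lparr>pv2 := (pv2 s)(j := - pv2 s j)\<rparr>)"
| piston_left: "left_approaching s j \<Longrightarrow> (\<forall>i<j. \<not> left_approaching s i) \<Longrightarrow>
     coll_step m1 m2 M s
       (s\<lparr>pV := piston_after (m1 j) M (pv1 s j) (pV s),
          pv1 := (pv1 s)(j := gas_after (m1 j) M (pv1 s j) (pV s))\<rparr>)"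
| piston_right: "(\<forall>i. \<not> left_approaching s i) \<Longrightarrow>
     right_approaching s j \<Longrightarrow> (\<forall>i<j. \<not> right_approaching s i) \<Longrightarrow>
     coll_step m1 m2 M s
       (s\<lparr>pV := piston_after (m2 j) M (pv2 s j) (pV s),
          pv2 := (pv2 s)(j := gas_after (m2 j) M (pv2 s j) (pV s))\<rparr>)"

definition resolve ::
  "('a::linorder \<Rightarrow> real) \<Rightarrow> ('b::linorder \<Rightarrow> real) \<Rightarrow> real
     \<Rightarrow> ('a, 'b) pstate \<Rightarrow> ('a, 'b) pstate \<Rightarrow> bool" where
  "resolve m1 m2 M s s' \<longleftrightarrow>
     (coll_step m1 m2 M)\<^sup>*\<^sup>* s s' \<and> \<not> (\<exists>s''. coll_step m1 m2 M s' s'')"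

text \<open>gamma is a motion of the system with piston mass M on the time interval [0,S]
  starting from the initial condition s0; gamma t is the (post-collision) state at time t.
  The motion consists of finitely many free flights, separated by instantaneous collisions.\<close>
definition is_motion ::
  "('a::linorder \<Rightarrow> real) \<Rightarrow> ('b::linorder \<Rightarrow> real) \<Rightarrow> real
     \<Rightarrow> ('a, 'b) pstate \<Rightarrow> real \<Rightarrow> (real \<Rightarrow> ('a, 'b) pstate) \<Rightarrow> bool" where
  "is_motion m1 m2 M s0 S \<gamma> \<longleftrightarrow> in_phase s0 \<and>
     (\<exists>(k::nat) (t::nat \<Rightarrow> real). t 0 = 0 \<and> t k = S \<and>
        resolve m1 m2 M s0 (\<gamma> 0) \<and>
        (\<forall>i<k. t i < t (Suc i)
           \<and> (\<forall>\<tau>. t i \<le> \<tau> \<and> \<tau> \<le> t (Suc i) \<longrightarrow> in_phase (flow (\<tau> - t i) (\<gamma> (t i))))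
           \<and> (\<forall>\<tau>. t i < \<tau> \<and> \<tau> < t (Suc i) \<longrightarrow> \<gamma> \<tau> = flow (\<tau> - t i) (\<gamma> (t i)))
           \<and> resolve m1 m2 M (flow (t (Suc i) - t i) (\<gamma> (t i))) (\<gamma> (t (Suc i)))))"

definition slow :: "real \<Rightarrow> ('a::finite, 'b::finite) pstate \<Rightarrow> real \<times> real \<times> (real^'a) \<times> (real^'b)" where
  "slow eps s = (pX s, pV s / eps, (\<chi> j. \<bar>pv1 s j\<bar>), (\<chi> j. \<bar>pv2 s j\<bar>))"

definition Hbar :: "('a::finite \<Rightarrow> real) \<Rightarrow> ('b::finite \<Rightarrow> real)
    \<Rightarrow> real \<times> real \<times> (real^'a) \<times> (real^'b) \<Rightarrow> real \<times> real \<times> (real^'a) \<times> (real^'b)" where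
  "Hbar m1 m2 h = (case h of (X, W, s1, s2) \<Rightarrow>
     (W,
      (\<Sum>j\<in>UNIV. m1 j * (s1 $ j)^2) / X - (\<Sum>j\<in>UNIV. m2 j * (s2 $ j)^2) / (1 - X),
      (\<chi> j. - (s1 $ j) * W / X),
      (\<chi> j. (s2 $ j) * W / (1 - X))))"

definition is_avg_solution :: "('a::finite \<Rightarrow> real) \<Rightarrow> ('b::finite \<Rightarrow> real)
    \<Rightarrow> real \<times> real \<times> (real^'a) \<times> (real^'b) \<Rightarrow> real
    \<Rightarrow> (real \<Rightarrow> real \<times> real \<times> (real^'a) \<times> (real^'b)) \<Rightarrow> bool" where
  "is_avg_solution m1 m2 h0 U hb \<longleftrightarrow> 0 \<le> U \<and> hb 0 = h0 \<and>
     (\<forall>\<tau>\<in>{0..U}. (hb has_vector_derivative Hbar m1 m2 (hb \<tau>)) (at \<tau> within {0..U}))"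

end

theory Submission
  imports Defs
begin

text \<open>Write \<open>L\<close> and \<open>N\<close> for \<open>mom1\<close> and \<open>mom2\<close>. Conservation of momentum makes
  \<open>V/\<epsilon> + \<epsilon>(L + N)\<close> exactly continuous through all collisions, and its
  derivative along free flights is, up to \<open>O(\<epsilon>)\<close>, the averaged force. The quantity
  \<open>|v X - V x|\<close> (an adiabatic invariant close to \<open>s X\<close>) is exactly
  conserved in free flight and in the collisions of its own particle; collisions of other particles
  change it by at most the jump of \<open>V\<close>. The total variation of \<open>V\<close> is \<open>O(\<epsilon>)\<close>,
  because \<open>L - N\<close> is bounded with bounded drift and decreases by \<open>M\<close> times
  each jump. Energy conservation bounds all velocities for all times, so neither collisions
  nor their order have to be controlled. Since \<open>s X\<close> is constant along the averaged equation as well,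
  what remains is a Gronwall estimate for \<open>(X, W)\<close>.\<close>

section \<open>Energy, weighted momenta and adiabatic quantities\<close>

definition energy :: "('a::finite \<Rightarrow> real) \<Rightarrow> ('b::finite \<Rightarrow> real) \<Rightarrow> real \<Rightarrow> ('a, 'b) pstate \<Rightarrow> real" where
  "energy m1 m2 M s = (\<Sum>j\<in>UNIV. m1 j * (pv1 s j)\<^sup>2) + (\<Sum>j\<in>UNIV. m2 j * (pv2 s j)\<^sup>2) + M * (pV s)\<^sup>2"

text \<open>The weight \<open>px1 s j / pX s\<close> is 0 at the wall and 1 at the piston. Hence a
  reflection at the wall leaves the sum unchanged, while a piston collision changes it by the full
  momentum transfer. \<open>mom2\<close> mirrors this on the right.\<close>

definition mom1 :: "('a::finite \<Rightarrow> real) \<Rightarrow> ('a, 'b) pstate \<Rightarrow> real" where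
  "mom1 m1 s = (\<Sum>j\<in>UNIV. m1 j * pv1 s j * px1 s j) / pX s"

definition mom2 :: "('b::finite \<Rightarrow> real) \<Rightarrow> ('a, 'b) pstate \<Rightarrow> real" where
  "mom2 m2 s = (\<Sum>j\<in>UNIV. m2 j * pv2 s j * (1 - px2 s j)) / (1 - pX s)"

text \<open>Without the absolute value this is the Wronskian of the affine motions of particle and
  piston, which is constant in free flight. A wall or piston collision of particle \<open>j\<close>
  itself only flips its sign.\<close>

definition inv1 :: "('a, 'b) pstate \<Rightarrow> 'a \<Rightarrow> real" where
  "inv1 s j = \<bar>pv1 s j * pX s - pV s * px1 s j\<bar>"

definition inv2 :: "('a, 'b) pstate \<Rightarrow> 'b \<Rightarrow> real" where
  "inv2 s j = \<bar>pv2 s j * (1 - pX s) - pV s * (1 - px2 s j)\<bar>"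

section \<open>Effect of a single collision\<close>

lemma sum_fun_upd:
  fixes f :: "'i::finite \<Rightarrow> real \<Rightarrow> real"
  shows "(\<Sum>j\<in>UNIV. f j ((v(k := w)) j)) = (\<Sum>j\<in>UNIV. f j (v j)) + (f k w - f k (v k))"
proof -
  have "(\<Sum>j\<in>UNIV. f j ((v(k := w)) j)) = f k w + (\<Sum>j\<in>UNIV - {k}. f j (v j))"
    by (subst sum.remove[of _ k]) (auto intro!: sum.cong)
  moreover have "(\<Sum>j\<in>UNIV. f j (v j)) = f k (v k) + (\<Sum>j\<in>UNIV - {k}. f j (v j))"
    by (subst sum.remove[of _ k]) auto
  ultimately show ?thesis by simp
qed

lemma coll_step_positions:
  assumes "coll_step m1 m2 M s s'"
  shows "pX s' = pX s" "px1 s' = px1 s" "px2 s' = px2 s"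
  using assms by (cases; simp)+

lemma collision_identities:
  fixes m M v V :: real
  assumes "m > 0" "M > 0"
  shows "m * (gas_after m M v V - v) = - M * (piston_after m M v V - V)"
    and "gas_after m M v V - piston_after m M v V = - (v - V)"
    and "piston_after m M v V - V = 2 * m * (v - V) / (m + M)"
    and "m * (gas_after m M v V)\<^sup>2 + M * (piston_after m M v V)\<^sup>2 = m * v\<^sup>2 + M * V\<^sup>2"
proof -
  have nz: "m + M \<noteq> 0" using assms by simp
  show 1: "m * (gas_after m M v V - v) = - M * (piston_after m M v V - V)"
    unfolding gas_after_def piston_after_def using nz by (simp add: field_simps)
  have "gas_after m M v V - piston_after m M v V = (m + M) * (V - v) / (m + M)"
    unfolding gas_after_def piston_after_def diff_divide_distrib[symmetric]
    by (rule arg_cong2[where f = "(/)"]) (simp_all add: algebra_simps)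
  then show 2: "gas_after m M v V - piston_after m M v V = - (v - V)"
    using nz by simp
  show "piston_after m M v V - V = 2 * m * (v - V) / (m + M)"
    unfolding gas_after_def piston_after_def using nz by (simp add: field_simps)
  define g p where "g = gas_after m M v V" and "p = piston_after m M v V"
  \<comment> \<open>Energy conservation follows from the first two identities: \<open>g - v\<close>
    is governed by the momentum balance, and \<open>g + v = p + V\<close> restates the reversal of
    the relative velocity.\<close>
  have "m * (g\<^sup>2 - v\<^sup>2) = m * (g - v) * (g + v)" by algebra
  also have "\<dots> = - M * (p - V) * (g + v)" using 1 by (simp add: g_def p_def)
  also have "g + v = p + V" using 2 by (simp add: g_def p_def)
  finally have "m * g\<^sup>2 + M * p\<^sup>2 = m * v\<^sup>2 + M * V\<^sup>2" by algebra
  then show "m * (gas_after m M v V)\<^sup>2 + M * (piston_after m M v V)\<^sup>2 = m * v\<^sup>2 + M * V\<^sup>2"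
    by (simp add: g_def p_def)
qed

lemma coll_step_energy:
  assumes "coll_step m1 m2 M s s'" and m1: "\<And>j. 0 < m1 j" and m2: "\<And>j. 0 < m2 j" and M: "0 < M"
  shows "energy m1 m2 M s' = energy m1 m2 M s"
  using assms(1)
proof cases
  case (wall_left j)
  then show ?thesis
    using sum_fun_upd[of "\<lambda>i x. m1 i * x\<^sup>2" "pv1 s" j "- pv1 s j"] by (simp add: energy_def)
next
  case (wall_right j)
  then show ?thesis
    using sum_fun_upd[of "\<lambda>i x. m2 i * x\<^sup>2" "pv2 s" j "- pv2 s j"] by (simp add: energy_def)
next
  case (piston_left j)
  then show ?thesis
    using sum_fun_upd[of "\<lambda>i x. m1 i * x\<^sup>2" "pv1 s" j "gas_after (m1 j) M (pv1 s j) (pV s)"]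
      collision_identities(4)[OF m1 M, of j "pv1 s j" "pV s"] by (simp add: energy_def)
next
  case (piston_right j)
  then show ?thesis
    using sum_fun_upd[of "\<lambda>i x. m2 i * x\<^sup>2" "pv2 s" j "gas_after (m2 j) M (pv2 s j) (pV s)"]
      collision_identities(4)[OF m2 M, of j "pv2 s j" "pV s"] by (simp add: energy_def)
qed

text \<open>Serves twice: it controls \<open>inv1\<close> and \<open>inv2\<close> when another
  particle changes the piston velocity, and with \<open>V = 0\<close> it compares them with speed
  times gap length.\<close>

lemma abs_affine_diff_le:
  fixes y V V' x :: real
  assumes "0 \<le> x" "x \<le> 1"
  shows "\<bar>\<bar>y - V' * x\<bar> - \<bar>y - V * x\<bar>\<bar> \<le> \<bar>V' - V\<bar>"
proof -
  have "\<bar>\<bar>y - V' * x\<bar> - \<bar>y - V * x\<bar>\<bar> \<le> \<bar>(y - V' * x) - (y - V * x)\<bar>" by (rule abs_triangle_ineq3)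
  also have "(y - V' * x) - (y - V * x) = - ((V' - V) * x)" by algebra
  also have "\<bar>- ((V' - V) * x)\<bar> = \<bar>V' - V\<bar> * x" using assms by (simp only: abs_minus_cancel abs_mult abs_of_nonneg)
  also have "\<dots> \<le> \<bar>V' - V\<bar>" using assms mult_left_mono[of x 1 "\<bar>V' - V\<bar>"] by simp
  finally show ?thesis .
qed

text \<open>The potential \<open>mom1 - mom2\<close> decreases by exactly \<open>M (d1 + d2)\<close>, which replaces
  any counting of the collisions.\<close>

lemma coll_step_jumps:
  fixes s s' :: "('a::{finite,linorder}, 'b::{finite,linorder}) pstate"
  assumes step: "coll_step m1 m2 M s s'" and m1: "\<And>j. 0 < m1 j" and m2: "\<And>j. 0 < m2 j"
    and M: "0 < M" and ph: "in_phase s"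
  obtains d1 d2 where "0 \<le> d1" "0 \<le> d2" "pV s' = pV s + d1 - d2"
    "mom1 m1 s' = mom1 m1 s - M * d1" "mom2 m2 s' = mom2 m2 s + M * d2"
    "\<And>j. \<bar>inv1 s' j - inv1 s j\<bar> \<le> d1 + d2" "\<And>j. \<bar>inv2 s' j - inv2 s j\<bar> \<le> d1 + d2"
proof -
  have X: "0 < pX s" "pX s < 1" and x1: "\<And>j. 0 \<le> px1 s j" "\<And>j. px1 s j \<le> 1"
    and x2: "\<And>j. 0 \<le> 1 - px2 s j" "\<And>j. 1 - px2 s j \<le> 1"
    using ph by (auto simp: in_phase_def) (smt (verit))+
  have A1: "\<bar>\<bar>y - V' * px1 s i\<bar> - \<bar>y - V * px1 s i\<bar>\<bar> \<le> \<bar>V' - V\<bar>" for y V V' i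
    by (rule abs_affine_diff_le[OF x1])
  have A2: "\<bar>\<bar>y - V' * (1 - px2 s i)\<bar> - \<bar>y - V * (1 - px2 s i)\<bar>\<bar> \<le> \<bar>V' - V\<bar>" for y V V' i
    by (rule abs_affine_diff_le[OF x2])
  show ?thesis
    using step
  proof cases
    case (wall_left j)
    have "mom1 m1 s' = mom1 m1 s"
      using sum_fun_upd[of "\<lambda>i x. m1 i * x * px1 s i" "pv1 s" j "- pv1 s j"] wall_left
      by (simp add: mom1_def)
    \<comment> \<open>The reflected particle sits where its weight is 0 and the piston velocity is
      untouched, so both jumps vanish.\<close>
    then show ?thesis using wall_left by (intro that[of 0 0]) (auto simp: mom2_def inv1_def inv2_def)
  next
    case (wall_right j)
    have "mom2 m2 s' = mom2 m2 s"
      using sum_fun_upd[of "\<lambda>i x. m2 i * x * (1 - px2 s i)" "pv2 s" j "- pv2 s j"] wall_right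
      by (simp add: mom2_def)
    then show ?thesis using wall_right by (intro that[of 0 0]) (auto simp: mom1_def inv1_def inv2_def)
  next
    case (piston_left j)
    let ?v = "pv1 s j" and ?V = "pV s"
    let ?v' = "gas_after (m1 j) M ?v ?V" and ?V' = "piston_after (m1 j) M ?v ?V"
    have app: "px1 s j = pX s" "?v > ?V" using piston_left by (auto simp: left_approaching_def)
    note ci = collision_identities[OF m1 M, of j ?v ?V]
    have d: "0 \<le> ?V' - ?V" unfolding ci(3) using app M m1[of j] by (intro divide_nonneg_pos mult_nonneg_nonneg) auto
    have "(\<Sum>i\<in>UNIV. m1 i * pv1 s' i * px1 s' i) =
        (\<Sum>i\<in>UNIV. m1 i * pv1 s i * px1 s i) + m1 j * (?v' - ?v) * pX s"
      using sum_fun_upd[of "\<lambda>i x. m1 i * x * px1 s i" "pv1 s" j ?v'] piston_left app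
      by (simp add: left_diff_distrib right_diff_distrib)
    then have "mom1 m1 s' = mom1 m1 s + (m1 j * (?v' - ?v) * pX s) / pX s"
      unfolding mom1_def coll_step_positions(1)[OF step] by (simp add: add_divide_distrib)
    then have L: "mom1 m1 s' = mom1 m1 s - M * (?V' - ?V)"
      using X ci(1) by simp
    \<comment> \<open>Particle \<open>j\<close> is at the piston, so its quantity is the relative
      speed times \<open>pX s\<close>, and the collision merely reverses the relative
      velocity.\<close>
    have own: "inv1 s' j = inv1 s j"
    proof -
      have "?v' * pX s - ?V' * pX s = - (?v - ?V) * pX s"
        using ci(2) by (metis left_diff_distrib)
      then show ?thesis using piston_left app by (simp add: inv1_def algebra_simps)
    qed
    have "\<bar>inv1 s' i - inv1 s i\<bar> \<le> ?V' - ?V" for i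
    proof (cases "i = j")
      case True
      then show ?thesis using own d by simp
    next
      case False
      then show ?thesis using A1[of "pv1 s i * pX s" ?V' i ?V] d piston_left by (simp add: inv1_def)
    qed
    moreover have "\<bar>inv2 s' i - inv2 s i\<bar> \<le> ?V' - ?V" for i
      using A2[of "pv2 s i * (1 - pX s)" ?V' i ?V] d piston_left by (simp add: inv2_def)
    \<comment> \<open>\<open>d1\<close> records forward pushes from the left and \<open>d2\<close>
      backward pushes from the right, so \<open>d1 + d2\<close> is the size of the velocity jump in
      either case.\<close>
    ultimately show ?thesis using d L piston_left by (intro that[of "?V' - ?V" 0]) (auto simp: mom2_def)
  next
    case (piston_right j)
    let ?v = "pv2 s j" and ?V = "pV s"
    let ?v' = "gas_after (m2 j) M ?v ?V" and ?V' = "piston_after (m2 j) M ?v ?V"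
    have app: "px2 s j = pX s" "?v < ?V" using piston_right by (auto simp: right_approaching_def)
    note ci = collision_identities[OF m2 M, of j ?v ?V]
    have d: "?V' - ?V \<le> 0" unfolding ci(3) using app M m2[of j]
      by (intro divide_nonpos_pos mult_nonneg_nonpos) auto
    have "(\<Sum>i\<in>UNIV. m2 i * pv2 s' i * (1 - px2 s' i)) =
        (\<Sum>i\<in>UNIV. m2 i * pv2 s i * (1 - px2 s i)) + m2 j * (?v' - ?v) * (1 - pX s)"
      using sum_fun_upd[of "\<lambda>i x. m2 i * x * (1 - px2 s i)" "pv2 s" j ?v'] piston_right app
      by (simp add: left_diff_distrib right_diff_distrib)
    then have "mom2 m2 s' = mom2 m2 s + (m2 j * (?v' - ?v) * (1 - pX s)) / (1 - pX s)"
      unfolding mom2_def coll_step_positions(1)[OF step] by (simp add: add_divide_distrib)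
    then have L: "mom2 m2 s' = mom2 m2 s + M * (?V - ?V')"
      using X ci(1) by simp (simp add: algebra_simps)
    have own: "inv2 s' j = inv2 s j"
    proof -
      have "?v' * (1 - pX s) - ?V' * (1 - pX s) = - (?v - ?V) * (1 - pX s)"
        using ci(2) by (metis left_diff_distrib)
      moreover have "?v * (1 - pX s) - ?V * (1 - pX s) = (?v - ?V) * (1 - pX s)" 
        by (simp add: algebra_simps)
      ultimately show ?thesis using piston_right app by (simp only: inv2_def) (simp add: abs_mult)
    qed
    have "\<bar>inv2 s' i - inv2 s i\<bar> \<le> ?V - ?V'" for i
    proof (cases "i = j")
      case True
      then show ?thesis using own d by simp
    next
      case False
      then show ?thesis using A2[of "pv2 s i * (1 - pX s)" ?V' i ?V] d piston_right by (simp add: inv2_def)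
    qed
    moreover have "\<bar>inv1 s' i - inv1 s i\<bar> \<le> ?V - ?V'" for i
      using A1[of "pv1 s i * pX s" ?V' i ?V] d piston_right by (simp add: inv1_def)
    ultimately show ?thesis using d L piston_right by (intro that[of 0 "?V - ?V'"]) (auto simp: mom1_def)
  qed
qed

section \<open>Free flight\<close>

lemma flow_sel [simp]:
  "pX (flow q s) = pX s + q * pV s" "pV (flow q s) = pV s"
  "px1 (flow q s) j = px1 s j + q * pv1 s j" "pv1 (flow q s) = pv1 s"
  "px2 (flow q s) i = px2 s i + q * pv2 s i" "pv2 (flow q s) = pv2 s"
  by (simp_all add: flow_def)

text \<open>The two terms \<open>q * v * V\<close> produced by the moving particle and the moving
  piston cancel.\<close>

lemma inv_flow [simp]: "inv1 (flow q s) j = inv1 s j" "inv2 (flow q s) i = inv2 s i"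
  unfolding inv1_def inv2_def by (simp_all add: algebra_simps)

lemma energy_flow [simp]: "energy m1 m2 M (flow q s) = energy m1 m2 M s"
  by (simp add: energy_def)

text \<open>The leading part, the sum of \<open>m1 j * (pv1 s j)^2\<close> over \<open>pX\<close>,
  is the averaged force of the left gas. The remainder carries the factor \<open>pV s\<close> and
  will be of order \<open>eps\<close>. For \<open>mom2\<close> the leading part is likewise the
  force of the right gas, with its negative sign.\<close>

lemma mom1_flow_deriv:
  assumes "pX (flow q s) \<noteq> 0"
  shows "((\<lambda>q. mom1 m1 (flow q s)) has_real_derivative
    ((\<Sum>j\<in>UNIV. m1 j * (pv1 s j)\<^sup>2) - pV s * mom1 m1 (flow q s)) / pX (flow q s)) (at q)"
proof -
  let ?K = "\<Sum>j\<in>UNIV. m1 j * (pv1 s j)\<^sup>2" and ?A = "\<Sum>j\<in>UNIV. m1 j * pv1 s j * px1 s j"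
  have eq: "mom1 m1 (flow q s) = (?A + q * ?K) / (pX s + q * pV s)" for q
    by (simp add: mom1_def sum_distrib_left sum.distrib algebra_simps power2_eq_square)
  have "((\<lambda>q. (?A + q * ?K) / (pX s + q * pV s)) has_real_derivative
      (?K * (pX s + q * pV s) - (?A + q * ?K) * pV s) / ((pX s + q * pV s) * (pX s + q * pV s))) (at q)"
    using assms by (auto intro!: derivative_eq_intros)
  moreover have "(?K * (pX s + q * pV s) - (?A + q * ?K) * pV s) / ((pX s + q * pV s) * (pX s + q * pV s))
      = (?K - pV s * ((?A + q * ?K) / (pX s + q * pV s))) / (pX s + q * pV s)"
    using assms by (simp add: field_simps)
  ultimately show ?thesis unfolding eq flow_sel by simp
qed

lemma mom2_flow_deriv:
  assumes "pX (flow q s) \<noteq> 1"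
  shows "((\<lambda>q. mom2 m2 (flow q s)) has_real_derivative
    (pV s * mom2 m2 (flow q s) - (\<Sum>j\<in>UNIV. m2 j * (pv2 s j)\<^sup>2)) / (1 - pX (flow q s))) (at q)"
proof -
  let ?K = "\<Sum>j\<in>UNIV. m2 j * (pv2 s j)\<^sup>2" and ?A = "\<Sum>j\<in>UNIV. m2 j * pv2 s j * (1 - px2 s j)"
  let ?X = "\<lambda>q. 1 - (pX s + q * pV s)"
  have eq: "mom2 m2 (flow q s) = (?A - q * ?K) / ?X q" for q
    by (simp add: mom2_def sum_distrib_left sum.distrib sum_subtractf algebra_simps power2_eq_square)
  have "((\<lambda>q. (?A - q * ?K) / ?X q) has_real_derivative
      ((- ?K) * ?X q - (?A - q * ?K) * (- pV s)) / (?X q * ?X q)) (at q)"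
    using assms by (auto intro!: derivative_eq_intros)
  moreover have "((- ?K) * ?X q - (?A - q * ?K) * (- pV s)) / (?X q * ?X q)
      = (pV s * ((?A - q * ?K) / ?X q) - ?K) / ?X q"
    using assms by (simp add: field_simps)
  ultimately show ?thesis unfolding eq flow_sel by simp
qed

section \<open>States reachable by collisions and safe flights\<close>

text \<open>Staying in the compact set is reduced to a margin \<open>a\<close> between the piston
  and the walls, since energy bounds the velocities.\<close>

definition safe :: "real \<Rightarrow> ('a, 'b) pstate \<Rightarrow> bool" where
  "safe a s \<longleftrightarrow> in_phase s \<and> a \<le> pX s \<and> pX s \<le> 1 - a"

text \<open>A motion in unscaled time is unfolded into single collisions and flights, so that
  estimates become inductions with one case per kind of event. Flights of any length may be cut
  short, which gives access to intermediate states and lets a trace end at an arbitrary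
  instant.\<close>

inductive reach ::
  "('a::linorder \<Rightarrow> real) \<Rightarrow> ('b::linorder \<Rightarrow> real) \<Rightarrow> real \<Rightarrow> real
     \<Rightarrow> ('a, 'b) pstate \<Rightarrow> real \<Rightarrow> ('a, 'b) pstate \<Rightarrow> bool"
  for m1 m2 M a s0 where
  start: "reach m1 m2 M a s0 0 s0"
| coll: "reach m1 m2 M a s0 t s \<Longrightarrow> coll_step m1 m2 M s s' \<Longrightarrow> reach m1 m2 M a s0 t s'"
| flight: "reach m1 m2 M a s0 t s \<Longrightarrow> 0 \<le> r \<Longrightarrow> (\<And>q. 0 \<le> q \<Longrightarrow> q \<le> r \<Longrightarrow> safe a (flow q s)) \<Longrightarrow>
     reach m1 m2 M a s0 (t + r) (flow r s)"

lemma reach_nonneg: "reach m1 m2 M a s0 t s \<Longrightarrow> 0 \<le> t"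
  by (induction rule: reach.induct) auto

lemma reach_resolve:
  assumes "reach m1 m2 M a s0 t s" "resolve m1 m2 M s s'"
  shows "reach m1 m2 M a s0 t s'"
proof -
  have "(coll_step m1 m2 M)\<^sup>*\<^sup>* s s'" using assms(2) by (simp add: resolve_def)
  then show ?thesis using assms(1) by (induction rule: rtranclp_induct) (auto intro: reach.coll)
qed

section \<open>Error constants and elementary inequalities\<close>

text \<open>The summands come from the values of \<open>mom1 - mom2\<close> at both ends, from its
  growth over a time \<open>T / eps\<close>, and from replacing the adiabatic quantity by speed
  times gap length at both ends.\<close>

definition drift_const :: "real \<Rightarrow> real \<Rightarrow> real \<Rightarrow> real \<Rightarrow> real" where
  "drift_const mu a R T = 2 * mu * R + 2 * mu * R\<^sup>2 / a * T + 2 * R"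

text \<open>Lipschitz constant in the piston position of the averaged force, both sides
  added.\<close>

definition lip_const :: "real \<Rightarrow> real \<Rightarrow> real \<Rightarrow> real" where
  "lip_const mu a R = 3 * mu * R\<^sup>2 / a ^ 6"

text \<open>The first summand is the error of the nearly conserved flux, the second that of the
  terms \<open>pV s * mom1\<close> and \<open>pV s * mom2\<close>.\<close>

definition force_const :: "real \<Rightarrow> real \<Rightarrow> real \<Rightarrow> real \<Rightarrow> real" where
  "force_const mu a R T = 2 * R * mu * drift_const mu a R T / a ^ 3 + mu * R\<^sup>2 / a"

text \<open>Gronwall bound for the squared error divided by \<open>eps^2\<close>: the exponential
  growth factor times initial error plus accumulated source.\<close>

definition err_const :: "real \<Rightarrow> real \<Rightarrow> real \<Rightarrow> real \<Rightarrow> real" where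
  "err_const mu a R T = exp ((2 + lip_const mu a R) * T) *
     ((mu * R)\<^sup>2 + ((mu * R)\<^sup>2 + (force_const mu a R T)\<^sup>2) * T)"

lemma abs_mean_le:
  fixes m z :: "'i::finite \<Rightarrow> real"
  assumes "\<And>j. 0 < m j" "\<And>j. \<bar>z j\<bar> \<le> r"
  shows "\<bar>\<Sum>j\<in>UNIV. m j * z j\<bar> \<le> sum m UNIV * r"
proof -
  have "\<bar>\<Sum>j\<in>UNIV. m j * z j\<bar> \<le> (\<Sum>j\<in>UNIV. \<bar>m j * z j\<bar>)" by (rule sum_abs)
  also have "\<dots> \<le> (\<Sum>j\<in>UNIV. m j * r)"
  proof (rule sum_mono)
    fix j show "\<bar>m j * z j\<bar> \<le> m j * r"
      using assms(1)[of j] assms(2)[of j] by (simp add: abs_mult)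
  qed
  finally show ?thesis by (simp add: sum_distrib_right)
qed

text \<open>Along the averaged equation speeds are inversely proportional to the gap length, so the
  force of each gas is a constant over the cube of that length.\<close>

lemma inverse_cube_lipschitz:
  fixes x y :: real
  assumes "0 < a" "a \<le> x" "x \<le> 1" "a \<le> y" "y \<le> 1"
  shows "\<bar>1 / x ^ 3 - 1 / y ^ 3\<bar> \<le> 3 / a ^ 6 * \<bar>x - y\<bar>"
proof -
  have p: "0 < x" "0 < y" using assms by auto
  have "1 / x ^ 3 - 1 / y ^ 3 = (y ^ 3 - x ^ 3) / (x ^ 3 * y ^ 3)"
    using p by (simp add: field_simps)
  also have "y ^ 3 - x ^ 3 = (y - x) * (x * x + x * y + y * y)" by algebra
  finally have "\<bar>1 / x ^ 3 - 1 / y ^ 3\<bar> = \<bar>y - x\<bar> * (x * x + x * y + y * y) / (x ^ 3 * y ^ 3)"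
    using p by (simp add: abs_mult)
  also have "\<dots> \<le> \<bar>y - x\<bar> * 3 / (a ^ 3 * a ^ 3)"
  proof (rule frac_le)
    have "x * x \<le> 1" "x * y \<le> 1" "y * y \<le> 1" using assms p by (auto intro!: mult_le_one)
    then show "\<bar>y - x\<bar> * (x * x + x * y + y * y) \<le> \<bar>y - x\<bar> * 3" by (intro mult_left_mono) auto
    show "a ^ 3 * a ^ 3 \<le> x ^ 3 * y ^ 3" using assms by (intro mult_mono power_mono) auto
  qed (use assms in auto)
  also have "\<dots> = 3 / a ^ 6 * \<bar>x - y\<bar>" by (simp add: abs_minus_commute flip: power_add)
  finally show ?thesis .
qed

text \<open>Here \<open>x\<close> and \<open>y\<close> are the errors in position and smoothed
  velocity, \<open>dx\<close> and \<open>dy\<close> their derivatives in unscaled time. Every mixed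
  product is split by \<open>2 * u * v \<le> u^2 + v^2\<close>, which leaves a Gronwall term and a
  source of order \<open>e^2\<close>.\<close>

lemma quadratic_growth:
  fixes x y dx dy :: real
  assumes "0 \<le> e" "0 \<le> l" "\<bar>dx - e * y\<bar> \<le> e * (e * b)" "\<bar>dy\<bar> \<le> e * (l * \<bar>x\<bar> + c * e)"
  shows "2 * x * dx + 2 * y * dy \<le> e * ((2 + l) * (x\<^sup>2 + y\<^sup>2) + (b\<^sup>2 + c\<^sup>2) * e\<^sup>2)"
proof -
  have "x * (dx - e * y) \<le> \<bar>x\<bar> * (e * (e * b))"
    by (rule order_trans[OF abs_ge_self]) (simp add: abs_mult mult_left_mono[OF assms(3)])
  moreover have "y * dy \<le> \<bar>y\<bar> * (e * (l * \<bar>x\<bar> + c * e))"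
    by (rule order_trans[OF abs_ge_self]) (simp add: abs_mult mult_left_mono[OF assms(4)])
  ultimately have "2 * x * dx + 2 * y * dy \<le>
      e * (2 * x * y + 2 * (\<bar>x\<bar> * (e * b)) + l * (2 * \<bar>x\<bar> * \<bar>y\<bar>) + 2 * (\<bar>y\<bar> * (c * e)))"
    by (simp add: algebra_simps)
  also have "\<dots> \<le> e * ((x\<^sup>2 + y\<^sup>2) + (x\<^sup>2 + (e * b)\<^sup>2) + l * (x\<^sup>2 + y\<^sup>2) + (y\<^sup>2 + (c * e)\<^sup>2))"
  proof -
    have "2 * x * y \<le> x\<^sup>2 + y\<^sup>2" by (rule sum_squares_bound)
    moreover have "2 * \<bar>x\<bar> * \<bar>y\<bar> \<le> x\<^sup>2 + y\<^sup>2" using sum_squares_bound[of "\<bar>x\<bar>" "\<bar>y\<bar>"] by simp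
    moreover have "2 * (\<bar>x\<bar> * (e * b)) \<le> x\<^sup>2 + (e * b)\<^sup>2" using sum_squares_bound[of "\<bar>x\<bar>" "e * b"] by simp
    moreover have "2 * (\<bar>y\<bar> * (c * e)) \<le> y\<^sup>2 + (c * e)\<^sup>2" using sum_squares_bound[of "\<bar>y\<bar>" "c * e"] by simp
    ultimately show ?thesis using assms by (intro mult_left_mono add_mono) auto
  qed
  also have "\<dots> = e * ((2 + l) * (x\<^sup>2 + y\<^sup>2) + (b\<^sup>2 + c\<^sup>2) * e\<^sup>2)"
    by (simp add: algebra_simps power2_eq_square)
  finally show ?thesis .
qed

text \<open>The error is split into moving the position from \<open>X\<close> to \<open>Y\<close> at
  fixed flux \<open>F\<close>, the defect of the flux \<open>K * X^2\<close>, and the correction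
  \<open>p\<close>. The right gas is covered by the complementary lengths \<open>1 - X\<close> and
  \<open>1 - Y\<close>.\<close>

lemma force_error:
  fixes K X Y p F :: real
  assumes "0 < a" "a \<le> X" "X \<le> 1" "a \<le> Y" "Y \<le> 1" "0 \<le> F" "F \<le> g" "\<bar>K * X\<^sup>2 - F\<bar> \<le> c" "\<bar>p\<bar> \<le> d"
  shows "\<bar>(K - p) / X - F / Y ^ 3\<bar> \<le> 3 * g / a ^ 6 * \<bar>X - Y\<bar> + (c / a ^ 3 + d / a)"
proof -
  have p: "0 < X" "0 < Y" using assms by auto
  have "(K - p) / X - F / Y ^ 3 = F * (1 / X ^ 3 - 1 / Y ^ 3) + ((K * X\<^sup>2 - F) / X ^ 3 - p / X)"
    using p by (simp add: field_simps power3_eq_cube power2_eq_square)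
  moreover have "\<bar>F * (1 / X ^ 3 - 1 / Y ^ 3)\<bar> \<le> g * (3 / a ^ 6 * \<bar>X - Y\<bar>)"
    unfolding abs_mult using assms by (intro mult_mono inverse_cube_lipschitz) auto
  moreover have "\<bar>(K * X\<^sup>2 - F) / X ^ 3\<bar> \<le> c / a ^ 3"
    unfolding abs_divide using assms p by (intro frac_le) (auto simp: power_mono)
  moreover have "\<bar>p / X\<bar> \<le> d / a"
    unfolding abs_divide using assms p by (intro frac_le) auto
  moreover have "g * (3 / a ^ 6 * \<bar>X - Y\<bar>) = 3 * g / a ^ 6 * \<bar>X - Y\<bar>" by simp
  ultimately show ?thesis by linarith
qed

section \<open>A priori bounds along a run\<close>

text \<open>One number \<open>R\<close> bounds everything: \<open>E0\<close> controls
  \<open>V / eps\<close>, because \<open>M * V^2 = (V / eps)^2\<close>, while \<open>E1\<close> and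
  \<open>E2\<close> control each single gas speed.\<close>

locale piston_run =
  fixes m1 :: "'a::{finite,linorder} \<Rightarrow> real" and m2 :: "'b::{finite,linorder} \<Rightarrow> real"
    and eps a R T :: real and s0 :: "('a, 'b) pstate"
  assumes m1: "\<And>j. 0 < m1 j" and m2: "\<And>j. 0 < m2 j"
    and eps: "0 < eps" "eps \<le> 1" and a: "0 < a" and R: "0 < R" and T: "0 < T"
    and safe0: "safe a s0"
    and E0: "energy m1 m2 (1 / eps\<^sup>2) s0 \<le> R\<^sup>2"
    and E1: "\<And>j. energy m1 m2 (1 / eps\<^sup>2) s0 \<le> m1 j * R\<^sup>2"
    and E2: "\<And>j. energy m1 m2 (1 / eps\<^sup>2) s0 \<le> m2 j * R\<^sup>2"
begin

abbreviation "rch \<equiv> reach m1 m2 (1 / eps\<^sup>2) a s0"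
abbreviation "mu \<equiv> sum m1 UNIV + sum m2 UNIV"

lemma mu: "0 < sum m1 UNIV" "0 < sum m2 UNIV"
  using m1 m2 by (auto intro!: sum_pos)

lemma M: "0 < 1 / eps\<^sup>2"
  using eps by simp

lemma reach_safe: "rch t s \<Longrightarrow> safe a s"
proof (induction rule: reach.induct)
  case (coll t s s')
  then show ?case using coll_step_positions[OF coll(2)] by (simp add: safe_def in_phase_def)
qed (use safe0 in auto)

lemma reach_energy: "rch t s \<Longrightarrow> energy m1 m2 (1 / eps\<^sup>2) s = energy m1 m2 (1 / eps\<^sup>2) s0"
  by (induction rule: reach.induct) (auto simp: coll_step_energy[OF _ m1 m2 M])

text \<open>Every summand of the conserved energy is nonnegative, so each is bounded by the initial
  energy, whatever the elapsed time.\<close>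

lemma reach_velocities:
  assumes "rch t s"
  shows "\<bar>pv1 s j\<bar> \<le> R" "\<bar>pv2 s i\<bar> \<le> R" "\<bar>pV s\<bar> \<le> eps * R"
proof -
  have e: "energy m1 m2 (1 / eps\<^sup>2) s = energy m1 m2 (1 / eps\<^sup>2) s0" by (rule reach_energy[OF assms])
  have n1: "0 \<le> (\<Sum>j\<in>UNIV. m1 j * (pv1 s j)\<^sup>2)" and n2: "0 \<le> (\<Sum>j\<in>UNIV. m2 j * (pv2 s j)\<^sup>2)"
    using m1 m2 by (auto intro!: sum_nonneg simp: less_imp_le)
  have n3: "0 \<le> 1 / eps\<^sup>2 * (pV s)\<^sup>2" by simp
  have "m1 j * (pv1 s j)\<^sup>2 \<le> (\<Sum>j\<in>UNIV. m1 j * (pv1 s j)\<^sup>2)"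
    using m1 by (intro member_le_sum) (auto simp: less_imp_le)
  then have "m1 j * (pv1 s j)\<^sup>2 \<le> m1 j * R\<^sup>2" using E1[of j] e n2 n3 unfolding energy_def by linarith
  then have "(pv1 s j)\<^sup>2 \<le> R\<^sup>2" using m1[of j] by simp
  then show "\<bar>pv1 s j\<bar> \<le> R" using power2_le_imp_le[of "\<bar>pv1 s j\<bar>" R] R by simp
  have "m2 i * (pv2 s i)\<^sup>2 \<le> (\<Sum>j\<in>UNIV. m2 j * (pv2 s j)\<^sup>2)"
    using m2 by (intro member_le_sum) (auto simp: less_imp_le)
  then have "m2 i * (pv2 s i)\<^sup>2 \<le> m2 i * R\<^sup>2" using E2[of i] e n1 n3 unfolding energy_def by linarith
  then have "(pv2 s i)\<^sup>2 \<le> R\<^sup>2" using m2[of i] by simp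
  then show "\<bar>pv2 s i\<bar> \<le> R" using power2_le_imp_le[of "\<bar>pv2 s i\<bar>" R] R by simp
  have "1 / eps\<^sup>2 * (pV s)\<^sup>2 \<le> R\<^sup>2" using E0 e n1 n2 unfolding energy_def by linarith
  then have "(pV s)\<^sup>2 \<le> (eps * R)\<^sup>2" using eps by (simp add: field_simps)
  then show "\<bar>pV s\<bar> \<le> eps * R" using power2_le_imp_le[of "\<bar>pV s\<bar>" "eps * R"] R eps by simp
qed

lemma safe_bounds:
  assumes "safe a s"
  shows "0 < pX s" "pX s < 1" "0 \<le> px1 s j" "px1 s j \<le> pX s" "px1 s j \<le> 1"
    "0 \<le> 1 - px2 s i" "1 - px2 s i \<le> 1 - pX s" "1 - px2 s i \<le> 1" "a \<le> pX s" "pX s \<le> 1 - a"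
  using assms by (auto simp: safe_def in_phase_def) (smt (verit))+

text \<open>The position weights lie between 0 and 1, so the bounds do not involve the margin
  \<open>a\<close>.\<close>

lemma reach_mom:
  assumes "rch t s"
  shows "\<bar>mom1 m1 s\<bar> \<le> sum m1 UNIV * R" "\<bar>mom2 m2 s\<bar> \<le> sum m2 UNIV * R"
proof -
  note b = safe_bounds[OF reach_safe[OF assms]] and v = reach_velocities[OF assms]
  have "\<bar>pv1 s j * px1 s j\<bar> \<le> R * pX s" for j
    using b(1) b(3,4)[of j] v(1)[of j] R by (auto simp: abs_mult intro!: mult_mono)
  then have "\<bar>\<Sum>j\<in>UNIV. m1 j * (pv1 s j * px1 s j)\<bar> \<le> sum m1 UNIV * (R * pX s)"
    by (intro abs_mean_le m1)
  then show "\<bar>mom1 m1 s\<bar> \<le> sum m1 UNIV * R"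
    using b(1) by (simp add: mom1_def field_simps)
  have "\<bar>pv2 s j * (1 - px2 s j)\<bar> \<le> R * (1 - pX s)" for j
    using b(2) b(6,7)[of j] v(2)[of j] R by (auto simp only: abs_mult intro!: mult_mono)
  then have "\<bar>\<Sum>j\<in>UNIV. m2 j * (pv2 s j * (1 - px2 s j))\<bar> \<le> sum m2 UNIV * (R * (1 - pX s))"
    by (intro abs_mean_le m2)
  then show "\<bar>mom2 m2 s\<bar> \<le> sum m2 UNIV * R"
    using b(2) by (simp add: mom2_def pos_divide_le_eq mult.assoc)
qed

section \<open>Near-conservation of the adiabatic quantities\<close>

text \<open>Collisions only lower \<open>mom1 - mom2\<close>. Bounding its growth in flight
  therefore limits how much it can drop in total, and with it the total variation of the piston
  velocity.\<close>

lemma flow_potential: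
  assumes s: "rch t s" and r: "0 \<le> r" and fl: "\<And>q. 0 \<le> q \<Longrightarrow> q \<le> r \<Longrightarrow> safe a (flow q s)"
  shows "mom1 m1 (flow r s) - mom2 m2 (flow r s) \<le> mom1 m1 s - mom2 m2 s + 2 * mu * R\<^sup>2 / a * r"
proof -
  let ?D = "2 * mu * R\<^sup>2 / a"
  let ?f = "\<lambda>q. mom1 m1 (flow q s) - mom2 m2 (flow q s) - ?D * q"
  have "?f r \<le> ?f 0"
  proof (rule DERIV_nonpos_imp_nonincreasing[OF r])
    fix q assume q: "0 \<le> q" "q \<le> r"
    have rq: "rch (t + q) (flow q s)" using reach.flight[OF s q(1)] fl q by auto
    note b = safe_bounds[OF reach_safe[OF rq]] and v = reach_velocities[OF rq] and mm = reach_mom[OF rq]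
    let ?K1 = "\<Sum>j\<in>UNIV. m1 j * (pv1 s j)\<^sup>2" and ?K2 = "\<Sum>j\<in>UNIV. m2 j * (pv2 s j)\<^sup>2"
    let ?p1 = "mom1 m1 (flow q s)" and ?p2 = "mom2 m2 (flow q s)" and ?X = "pX (flow q s)"
    have sq: "\<bar>z\<^sup>2\<bar> \<le> R\<^sup>2" if "\<bar>z\<bar> \<le> R" for z using power_mono[OF that, of 2] by simp
    have K1: "?K1 \<le> sum m1 UNIV * R\<^sup>2" "?K2 \<le> sum m2 UNIV * R\<^sup>2"
      using abs_mean_le[of m1 "\<lambda>j. (pv1 s j)\<^sup>2" "R\<^sup>2", OF m1 sq] abs_mean_le[of m2 "\<lambda>j. (pv2 s j)\<^sup>2" "R\<^sup>2", OF m2 sq] v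
      by auto
    \<comment> \<open>Here \<open>eps \<le> 1\<close> is used to keep the growth rate independent of
      \<open>eps\<close>.\<close>
    have V: "\<bar>pV s\<bar> \<le> R" using reach_velocities(3)[OF s] mult_right_mono[OF eps(2), of R] R by linarith
    have Vp: "\<bar>pV s * ?p1\<bar> \<le> R * (sum m1 UNIV * R)" "\<bar>pV s * ?p2\<bar> \<le> R * (sum m2 UNIV * R)"
      unfolding abs_mult using V mm R mu by (intro mult_mono; simp)+
    have d: "(?f has_real_derivative (?K1 - pV s * ?p1) / ?X - (pV s * ?p2 - ?K2) / (1 - ?X) - ?D) (at q)"
      using b(1,2) by (intro DERIV_diff mom1_flow_deriv mom2_flow_deriv DERIV_cmult_Id) auto
    have N: "?K1 - pV s * ?p1 \<le> 2 * sum m1 UNIV * R\<^sup>2" "- (pV s * ?p2 - ?K2) \<le> 2 * sum m2 UNIV * R\<^sup>2"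
      using K1 abs_le_D2[OF Vp(1)] abs_le_D2[OF Vp(2)] by (simp_all add: power2_eq_square algebra_simps)
    have "(?K1 - pV s * ?p1) / ?X \<le> (2 * sum m1 UNIV * R\<^sup>2) / a"
      using b(9) a mu by (intro frac_le N(1)) auto
    moreover have "- (pV s * ?p2 - ?K2) / (1 - ?X) \<le> (2 * sum m2 UNIV * R\<^sup>2) / a"
      using b(10) a mu by (intro frac_le N(2)) auto
    moreover have "?D = (2 * sum m1 UNIV * R\<^sup>2) / a + (2 * sum m2 UNIV * R\<^sup>2) / a"
      by (simp add: algebra_simps add_divide_distrib)
    ultimately have "(?K1 - pV s * ?p1) / ?X - (pV s * ?p2 - ?K2) / (1 - ?X) - ?D \<le> 0"
      unfolding minus_divide_left[symmetric] by linarith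
    with d show "\<exists>y. (?f has_real_derivative y) (at q) \<and> y \<le> 0" by blast
  qed
  then show ?thesis by (simp add: flow_def)
qed

text \<open>The right-hand side is an accounting function that dominates the summed velocity jumps:
  a collision raises it by exactly \<open>d1 + d2\<close>, as \<open>eps^2\<close> is the inverse
  piston mass, and a flight never lowers it.\<close>

lemma reach_inv_drift:
  assumes "rch t s"
  shows "\<bar>inv1 s j - inv1 s0 j\<bar> \<le> eps\<^sup>2 * (mom1 m1 s0 - mom2 m2 s0 - (mom1 m1 s - mom2 m2 s) + 2 * mu * R\<^sup>2 / a * t)"
    and "\<bar>inv2 s i - inv2 s0 i\<bar> \<le> eps\<^sup>2 * (mom1 m1 s0 - mom2 m2 s0 - (mom1 m1 s - mom2 m2 s) + 2 * mu * R\<^sup>2 / a * t)"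
proof -
  let ?D = "2 * mu * R\<^sup>2 / a"
  define B where "B t s = eps\<^sup>2 * (mom1 m1 s0 - mom2 m2 s0 - (mom1 m1 s - mom2 m2 s) + ?D * t)" for t s
  have lin: "e * (x - (p - c * d1 - (p' + c * d2)) + y) = e * (x - (p - p') + y) + (d1 + d2)"
    if "e * c = 1" for e c x y p p' d1 d2 :: real
  proof -
    have "e * (x - (p - c * d1 - (p' + c * d2)) + y) = e * (x - (p - p') + y) + (e * c) * (d1 + d2)"
      by (simp add: algebra_simps)
    then show ?thesis using that by simp
  qed
  have tri: "\<bar>x - z\<bar> \<le> b + c" if "\<bar>y - z\<bar> \<le> b" "\<bar>x - y\<bar> \<le> c" for x y z b c :: real
    using that by linarith
  have C: "\<bar>inv1 s j - inv1 s0 j\<bar> \<le> B t s \<and> \<bar>inv2 s i - inv2 s0 i\<bar> \<le> B t s"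
    using assms
  proof (induction rule: reach.induct)
    case start
    show ?case by (simp add: B_def)
  next
    case (coll t s s')
    obtain d1 d2 where d: "0 \<le> d1" "0 \<le> d2" "pV s' = pV s + d1 - d2"
      "mom1 m1 s' = mom1 m1 s - 1 / eps\<^sup>2 * d1" "mom2 m2 s' = mom2 m2 s + 1 / eps\<^sup>2 * d2"
      "\<And>j. \<bar>inv1 s' j - inv1 s j\<bar> \<le> d1 + d2" "\<And>j. \<bar>inv2 s' j - inv2 s j\<bar> \<le> d1 + d2"
      using coll_step_jumps[OF coll(2) m1 m2 M] reach_safe[OF coll(1)] unfolding safe_def by blast
    have "B t s' = B t s + (d1 + d2)"
      unfolding B_def d(4,5) by (rule lin) (use eps in simp)
    then show ?case using tri coll.IH d(6)[of j] d(7)[of i] by metis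
  next
    case (flight t s r)
    have "B t s \<le> B (t + r) (flow r s)"
      unfolding B_def using flow_potential[OF flight(1,2,3)]
      by (intro mult_left_mono) (auto simp: distrib_left)
    then show ?case using flight.IH unfolding inv_flow by (meson order_trans)
  qed
  note D = conjunct1[OF C, unfolded B_def] conjunct2[OF C, unfolded B_def]
  show "\<bar>inv1 s j - inv1 s0 j\<bar> \<le> eps\<^sup>2 * (mom1 m1 s0 - mom2 m2 s0 - (mom1 m1 s - mom2 m2 s) + ?D * t)"
    "\<bar>inv2 s i - inv2 s0 i\<bar> \<le> eps\<^sup>2 * (mom1 m1 s0 - mom2 m2 s0 - (mom1 m1 s - mom2 m2 s) + ?D * t)"
    by (rule D)+
qed

text \<open>The bounded potential contributes order \<open>eps^2\<close> to the drift, and its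
  growth over times up to \<open>T / eps\<close> contributes order \<open>eps\<close>. Passing from
  \<open>inv1\<close> and \<open>inv2\<close> to speed times gap length costs at most the piston
  velocity at each end.\<close>

lemma reach_adiabatic:
  assumes s: "rch t s" and t: "eps * t \<le> T"
  shows "\<bar>\<bar>pv1 s j\<bar> * pX s - \<bar>pv1 s0 j\<bar> * pX s0\<bar> \<le> eps * drift_const mu a R T"
    and "\<bar>\<bar>pv2 s i\<bar> * (1 - pX s) - \<bar>pv2 s0 i\<bar> * (1 - pX s0)\<bar> \<le> eps * drift_const mu a R T"
proof -
  let ?D = "2 * mu * R\<^sup>2 / a"
  define \<phi> where "\<phi> = mom1 m1 s0 - mom2 m2 s0 - (mom1 m1 s - mom2 m2 s)"
  define \<beta> where "\<beta> = eps * (2 * mu * R + ?D * T)"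
  have D: "0 \<le> ?D" using mu a by simp
  have s0: "rch 0 s0" by (rule reach.start)
  have "\<phi> \<le> 2 * mu * R"
  proof -
    have "\<phi> \<le> \<bar>mom1 m1 s0\<bar> + \<bar>mom2 m2 s0\<bar> + (\<bar>mom1 m1 s\<bar> + \<bar>mom2 m2 s\<bar>)"
      unfolding \<phi>_def by linarith
    also have "\<dots> \<le> sum m1 UNIV * R + sum m2 UNIV * R + (sum m1 UNIV * R + sum m2 UNIV * R)"
      by (intro add_mono reach_mom[OF s] reach_mom[OF s0])
    also have "\<dots> = 2 * mu * R" by (simp add: algebra_simps)
    finally show ?thesis .
  qed
  then have "eps * \<phi> \<le> eps * (2 * mu * R)"
    using eps by (intro mult_left_mono) auto
  \<comment> \<open>The contribution of order \<open>eps^2\<close> is coarsened to order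
    \<open>eps\<close> so that both parts fit into \<open>\<beta>\<close>.\<close>
  moreover have "eps * (2 * mu * R) \<le> 1 * (2 * mu * R)"
    using eps mu R by (intro mult_right_mono) auto
  moreover have "?D * (eps * t) \<le> ?D * T" by (rule mult_left_mono[OF t D])
  ultimately have "eps * (\<phi> + ?D * t) \<le> 2 * mu * R + ?D * T" by (simp add: algebra_simps)
  then have "eps\<^sup>2 * (\<phi> + ?D * t) \<le> \<beta>"
    unfolding \<beta>_def power2_eq_square mult.assoc[of eps eps] using eps by (intro mult_left_mono) auto
  then have I: "\<bar>inv1 s j - inv1 s0 j\<bar> \<le> \<beta>" "\<bar>inv2 s i - inv2 s0 i\<bar> \<le> \<beta>"
    using reach_inv_drift(1)[OF s, of j] reach_inv_drift(2)[OF s, of i]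
    unfolding \<phi>_def[symmetric] by (blast intro: order_trans)+
  have near1: "\<bar>\<bar>pv1 s j\<bar> * pX s - inv1 s j\<bar> \<le> eps * R" if "rch t s" for t s
  proof -
    note b = safe_bounds[OF reach_safe[OF that]]
    have "\<bar>inv1 s j - \<bar>pv1 s j * pX s\<bar>\<bar> \<le> \<bar>pV s\<bar>"
      using abs_affine_diff_le[OF b(3)[of j] b(5)[of j], where y = "pv1 s j * pX s" and V' = "pV s" and V = 0] by (simp add: inv1_def)
    then show ?thesis using b(1) reach_velocities(3)[OF that] by (simp add: abs_mult abs_minus_commute)
  qed
  have near2: "\<bar>\<bar>pv2 s i\<bar> * (1 - pX s) - inv2 s i\<bar> \<le> eps * R" if "rch t s" for t s
  proof -
    note b = safe_bounds[OF reach_safe[OF that]]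
    have "\<bar>inv2 s i - \<bar>pv2 s i * (1 - pX s)\<bar>\<bar> \<le> \<bar>pV s\<bar>"
      using abs_affine_diff_le[OF b(6)[of i] b(8)[of i], where y = "pv2 s i * (1 - pX s)" and V' = "pV s" and V = 0] by (simp add: inv2_def)
    then show ?thesis using b(2) reach_velocities(3)[OF that] by (simp add: abs_mult abs_minus_commute)
  qed
  have eq: "eps * drift_const mu a R T = \<beta> + eps * R + eps * R"
    by (simp add: drift_const_def \<beta>_def algebra_simps)
  have tri: "\<bar>x - y\<bar> \<le> \<beta> + eps * R + eps * R"
    if "\<bar>x - x'\<bar> \<le> eps * R" "\<bar>y - y'\<bar> \<le> eps * R" "\<bar>x' - y'\<bar> \<le> \<beta>" for x x' y y'
    using that by linarith
  show "\<bar>\<bar>pv1 s j\<bar> * pX s - \<bar>pv1 s0 j\<bar> * pX s0\<bar> \<le> eps * drift_const mu a R T"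
    unfolding eq by (rule tri[OF near1[OF s] near1[OF s0] I(1)])
  show "\<bar>\<bar>pv2 s i\<bar> * (1 - pX s) - \<bar>pv2 s0 i\<bar> * (1 - pX s0)\<bar> \<le> eps * drift_const mu a R T"
    unfolding eq by (rule tri[OF near2[OF s] near2[OF s0] I(2)])
qed

text \<open>Summing squares of the nearly conserved quantities shows that the gas energy times the
  squared gap length is nearly constant. The factor \<open>2 * R\<close> bounds the sum of the two
  roots.\<close>

lemma reach_flux:
  assumes s: "rch t s" and t: "eps * t \<le> T"
  shows "\<bar>(\<Sum>j\<in>UNIV. m1 j * (pv1 s j)\<^sup>2) * (pX s)\<^sup>2 - (\<Sum>j\<in>UNIV. m1 j * (\<bar>pv1 s0 j\<bar> * pX s0)\<^sup>2)\<bar>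
      \<le> sum m1 UNIV * (eps * drift_const mu a R T * (2 * R))"
    and "\<bar>(\<Sum>j\<in>UNIV. m2 j * (pv2 s j)\<^sup>2) * (1 - pX s)\<^sup>2 - (\<Sum>j\<in>UNIV. m2 j * (\<bar>pv2 s0 j\<bar> * (1 - pX s0))\<^sup>2)\<bar>
      \<le> sum m2 UNIV * (eps * drift_const mu a R T * (2 * R))"
proof -
  have s0: "rch 0 s0" by (rule reach.start)
  note b = safe_bounds(1,2)[OF reach_safe[OF s]] safe_bounds(1,2)[OF safe0]
    and v = reach_velocities(1,2)[OF s] reach_velocities(1,2)[OF s0]
  have sq: "\<bar>x\<^sup>2 - y\<^sup>2\<bar> \<le> d * (2 * R)"
    if "\<bar>x - y\<bar> \<le> d" "0 \<le> x" "x \<le> R" "0 \<le> y" "y \<le> R" for x y d :: real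
  proof -
    have "\<bar>x\<^sup>2 - y\<^sup>2\<bar> = \<bar>x - y\<bar> * (x + y)"
      using that unfolding power2_eq_square square_diff_square_factored abs_mult by simp
    also have "\<dots> \<le> d * (2 * R)" using that by (intro mult_mono) auto
    finally show ?thesis .
  qed
  have prod: "0 \<le> \<bar>x\<bar> * y" "\<bar>x\<bar> * y \<le> R" if "\<bar>x\<bar> \<le> R" "0 < y" "y < 1" for x y :: real
    using that mult_mono[of "\<bar>x\<bar>" R y 1] R by auto
  have "\<bar>\<Sum>j\<in>UNIV. m1 j * ((\<bar>pv1 s j\<bar> * pX s)\<^sup>2 - (\<bar>pv1 s0 j\<bar> * pX s0)\<^sup>2)\<bar>
      \<le> sum m1 UNIV * (eps * drift_const mu a R T * (2 * R))"
    using b by (intro abs_mean_le m1 sq prod reach_adiabatic(1)[OF s t] v) auto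
  then show "\<bar>(\<Sum>j\<in>UNIV. m1 j * (pv1 s j)\<^sup>2) * (pX s)\<^sup>2 - (\<Sum>j\<in>UNIV. m1 j * (\<bar>pv1 s0 j\<bar> * pX s0)\<^sup>2)\<bar>
      \<le> sum m1 UNIV * (eps * drift_const mu a R T * (2 * R))"
    by (simp only: power_mult_distrib power2_abs sum_distrib_right right_diff_distrib sum_subtractf mult.assoc)
  have "\<bar>\<Sum>j\<in>UNIV. m2 j * ((\<bar>pv2 s j\<bar> * (1 - pX s))\<^sup>2 - (\<bar>pv2 s0 j\<bar> * (1 - pX s0))\<^sup>2)\<bar>
      \<le> sum m2 UNIV * (eps * drift_const mu a R T * (2 * R))"
    using b by (intro abs_mean_le m2 sq prod reach_adiabatic(2)[OF s t] v) auto
  then show "\<bar>(\<Sum>j\<in>UNIV. m2 j * (pv2 s j)\<^sup>2) * (1 - pX s)\<^sup>2 - (\<Sum>j\<in>UNIV. m2 j * (\<bar>pv2 s0 j\<bar> * (1 - pX s0))\<^sup>2)\<bar>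
      \<le> sum m2 UNIV * (eps * drift_const mu a R T * (2 * R))"
    by (simp only: power_mult_distrib power2_abs sum_distrib_right right_diff_distrib[of "m2 _"] sum_subtractf mult.assoc)
qed

section \<open>Smoothed piston velocity and Gronwall estimate\<close>

text \<open>With \<open>M = 1 / eps^2\<close> this equals
  \<open>eps * (M * pV s + mom1 m1 s + mom2 m2 s)\<close>, a rescaled total momentum with position
  weights on the gas.\<close>

definition W_smooth :: "('a, 'b) pstate \<Rightarrow> real" where
  "W_smooth s = pV s / eps + eps * (mom1 m1 s + mom2 m2 s)"

lemma W_smooth_coll:
  assumes "rch t s" "coll_step m1 m2 (1 / eps\<^sup>2) s s'"
  shows "W_smooth s' = W_smooth s"
proof -
  have ph: "in_phase s" using reach_safe[OF assms(1)] by (simp add: safe_def)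
  obtain d1 d2 where d: "pV s' = pV s + d1 - d2"
    "mom1 m1 s' = mom1 m1 s - 1 / eps\<^sup>2 * d1" "mom2 m2 s' = mom2 m2 s + 1 / eps\<^sup>2 * d2"
    by (rule coll_step_jumps[OF assms(2) m1 m2 M ph]) (rule that)
  have lin: "(V + d1 - d2) * k + e * ((p - c * d1) + (p' + c * d2)) = V * k + e * (p + p')"
    if "e * c = k" for V k e c p p' :: real
    unfolding that[symmetric] by (simp add: algebra_simps)
  have "eps * (1 / eps\<^sup>2) = 1 / eps" using eps by (simp add: power2_eq_square)
  from lin[OF this]
  have "(pV s + d1 - d2) * (1 / eps) + eps * ((mom1 m1 s - 1 / eps\<^sup>2 * d1) + (mom2 m2 s + 1 / eps\<^sup>2 * d2))
      = pV s * (1 / eps) + eps * (mom1 m1 s + mom2 m2 s)" .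
  then show ?thesis unfolding W_smooth_def d by (simp only: times_divide_eq_right mult_1_right)
qed

lemma W_smooth_near:
  assumes "rch t s"
  shows "\<bar>pV s / eps - W_smooth s\<bar> \<le> eps * (mu * R)"
proof -
  have "\<bar>mom1 m1 s + mom2 m2 s\<bar> \<le> mu * R"
    using reach_mom[OF assms] by (simp add: distrib_right)
  then show ?thesis using eps by (simp add: W_smooth_def abs_mult)
qed

text \<open>Fluxes frozen at the initial state. The averaged equation conserves them, so its force
  at piston position \<open>Y\<close> is \<open>F1 / Y ^ 3 - F2 / (1 - Y) ^ 3\<close>.\<close>

abbreviation "F1 \<equiv> \<Sum>j\<in>UNIV. m1 j * (\<bar>pv1 s0 j\<bar> * pX s0)\<^sup>2"
abbreviation "F2 \<equiv> \<Sum>j\<in>UNIV. m2 j * (\<bar>pv2 s0 j\<bar> * (1 - pX s0))\<^sup>2"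

lemma F_bounds: "0 \<le> F1" "F1 \<le> sum m1 UNIV * R\<^sup>2" "0 \<le> F2" "F2 \<le> sum m2 UNIV * R\<^sup>2"
proof -
  note b = safe_bounds[OF safe0] and v = reach_velocities[OF reach.start]
  show "0 \<le> F1" "0 \<le> F2"
    using m1 m2 by (auto intro!: sum_nonneg simp: less_imp_le)
  have sq: "\<bar>(\<bar>x\<bar> * y)\<^sup>2\<bar> \<le> R\<^sup>2" if "\<bar>x\<bar> \<le> R" "0 < y" "y < 1" for x y :: real
  proof -
    have "\<bar>x\<bar> * y \<le> R * 1" using that R by (intro mult_mono) auto
    then show ?thesis using that power_mono[of "\<bar>x\<bar> * y" R 2] by simp
  qed
  have "\<bar>F1\<bar> \<le> sum m1 UNIV * R\<^sup>2" by (intro abs_mean_le m1 sq v b)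
  then show "F1 \<le> sum m1 UNIV * R\<^sup>2" by simp
  have "\<bar>F2\<bar> \<le> sum m2 UNIV * R\<^sup>2" using b by (intro abs_mean_le m2 sq v) auto
  then show "F2 \<le> sum m2 UNIV * R\<^sup>2" by simp
qed

text \<open>The first two terms on the left are the derivative of \<open>W_smooth\<close> in slow
  time. \<open>force_error\<close> is applied to each gas separately and the two errors are
  added.\<close>

lemma force_bound:
  assumes s: "rch t s" and t: "eps * t \<le> T" and Y: "a \<le> Y" "Y \<le> 1 - a"
  shows "\<bar>((\<Sum>j\<in>UNIV. m1 j * (pv1 s j)\<^sup>2) - pV s * mom1 m1 s) / pX s
        + (pV s * mom2 m2 s - (\<Sum>j\<in>UNIV. m2 j * (pv2 s j)\<^sup>2)) / (1 - pX s)
        - (F1 / Y ^ 3 - F2 / (1 - Y) ^ 3)\<bar>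
      \<le> lip_const mu a R * \<bar>pX s - Y\<bar> + force_const mu a R T * eps"
proof -
  let ?K1 = "\<Sum>j\<in>UNIV. m1 j * (pv1 s j)\<^sup>2" and ?K2 = "\<Sum>j\<in>UNIV. m2 j * (pv2 s j)\<^sup>2"
  let ?s1 = "sum m1 UNIV" and ?s2 = "sum m2 UNIV" and ?\<kappa> = "drift_const mu a R T"
  note b = safe_bounds[OF reach_safe[OF s]]
  have p: "\<bar>pV s * mom1 m1 s\<bar> \<le> eps * R * (?s1 * R)" "\<bar>pV s * mom2 m2 s\<bar> \<le> eps * R * (?s2 * R)"
    unfolding abs_mult using reach_velocities(3)[OF s] reach_mom[OF s] eps R by (intro mult_mono; simp)+
  have e1: "\<bar>(?K1 - pV s * mom1 m1 s) / pX s - F1 / Y ^ 3\<bar>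
      \<le> 3 * (?s1 * R\<^sup>2) / a ^ 6 * \<bar>pX s - Y\<bar> + (?s1 * (eps * ?\<kappa> * (2 * R)) / a ^ 3 + eps * R * (?s1 * R) / a)"
    using b a Y by (intro force_error reach_flux[OF s t] F_bounds p) auto
  have e2: "\<bar>(?K2 - pV s * mom2 m2 s) / (1 - pX s) - F2 / (1 - Y) ^ 3\<bar>
      \<le> 3 * (?s2 * R\<^sup>2) / a ^ 6 * \<bar>1 - pX s - (1 - Y)\<bar> + (?s2 * (eps * ?\<kappa> * (2 * R)) / a ^ 3 + eps * R * (?s2 * R) / a)"
    using b(1,2,9,10) a Y by (intro force_error reach_flux[OF s t] F_bounds p) auto
  have dist: "\<bar>1 - pX s - (1 - Y)\<bar> = \<bar>pX s - Y\<bar>" by linarith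
  have neg: "(pV s * mom2 m2 s - ?K2) / (1 - pX s) = - ((?K2 - pV s * mom2 m2 s) / (1 - pX s))"
    by (simp add: minus_divide_left)
  have tri: "\<bar>x + - y - (f - g)\<bar> \<le> c + d" if "\<bar>x - f\<bar> \<le> c" "\<bar>y - g\<bar> \<le> d" for x y f g c d :: real
    using that by linarith
  have "\<bar>(?K1 - pV s * mom1 m1 s) / pX s + (pV s * mom2 m2 s - ?K2) / (1 - pX s) - (F1 / Y ^ 3 - F2 / (1 - Y) ^ 3)\<bar>
      \<le> (3 * (?s1 * R\<^sup>2) / a ^ 6 * \<bar>pX s - Y\<bar> + (?s1 * (eps * ?\<kappa> * (2 * R)) / a ^ 3 + eps * R * (?s1 * R) / a))
       + (3 * (?s2 * R\<^sup>2) / a ^ 6 * \<bar>pX s - Y\<bar> + (?s2 * (eps * ?\<kappa> * (2 * R)) / a ^ 3 + eps * R * (?s2 * R) / a))"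
    unfolding neg by (rule tri[OF e1 e2[unfolded dist]])
  also have "\<dots> = lip_const mu a R * \<bar>pX s - Y\<bar> + force_const mu a R T * eps"
    unfolding lip_const_def force_const_def
    by (simp add: algebra_simps add_divide_distrib power2_eq_square)
  finally show ?thesis .
qed

lemma W_smooth_flow_deriv:
  assumes "safe a (flow q s)"
  shows "((\<lambda>q. W_smooth (flow q s)) has_real_derivative
    eps * (((\<Sum>j\<in>UNIV. m1 j * (pv1 s j)\<^sup>2) - pV s * mom1 m1 (flow q s)) / pX (flow q s)
        + (pV s * mom2 m2 (flow q s) - (\<Sum>j\<in>UNIV. m2 j * (pv2 s j)\<^sup>2)) / (1 - pX (flow q s)))) (at q)"
proof -
  have "pX (flow q s) \<noteq> 0" "pX (flow q s) \<noteq> 1" using safe_bounds(1,2)[OF assms] by auto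
  note d = DERIV_cmult[OF DERIV_add[OF mom1_flow_deriv[OF this(1), of m1] mom2_flow_deriv[OF this(2), of m2]], of eps]
  show ?thesis
    unfolding W_smooth_def using DERIV_add[OF DERIV_const[of "pV s / eps"] d] by simp
qed

text \<open>The left-hand side is a Lyapunov function along the trace: it does not increase in
  flight, and collisions leave it unchanged because they alter neither the position nor
  \<open>W_smooth\<close>.\<close>

lemma gronwall_reach:
  fixes Xb Wb :: "real \<Rightarrow> real"
  assumes cX: "continuous_on {0..\<tau>0} Xb" and cW: "continuous_on {0..\<tau>0} Wb"
    and dX: "\<And>\<sigma>. 0 < \<sigma> \<Longrightarrow> \<sigma> < \<tau>0 \<Longrightarrow> (Xb has_real_derivative Wb \<sigma>) (at \<sigma>)"
    and dW: "\<And>\<sigma>. 0 < \<sigma> \<Longrightarrow> \<sigma> < \<tau>0 \<Longrightarrow>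
      (Wb has_real_derivative F1 / Xb \<sigma> ^ 3 - F2 / (1 - Xb \<sigma>) ^ 3) (at \<sigma>)"
    and rX: "\<And>\<sigma>. 0 < \<sigma> \<Longrightarrow> \<sigma> < \<tau>0 \<Longrightarrow> a \<le> Xb \<sigma> \<and> Xb \<sigma> \<le> 1 - a"
    and T0: "\<tau>0 \<le> T"
    and s: "rch t s" and t: "eps * t \<le> \<tau>0"
  defines "L \<equiv> 2 + lip_const mu a R" and "c \<equiv> (mu * R)\<^sup>2 + (force_const mu a R T)\<^sup>2"
  shows "exp (- L * (eps * t)) * ((pX s - Xb (eps * t))\<^sup>2 + (W_smooth s - Wb (eps * t))\<^sup>2) - c * eps\<^sup>2 * (eps * t)
    \<le> (pX s0 - Xb 0)\<^sup>2 + (W_smooth s0 - Wb 0)\<^sup>2"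
  using s t
proof (induction rule: reach.induct)
  case start
  show ?case by simp
next
  case (coll t s s')
  then show ?case using W_smooth_coll[OF coll(1,2)] coll_step_positions(1)[OF coll(2)] by simp
next
  case (flight t s r)
  have lip: "0 \<le> lip_const mu a R" using mu a by (simp add: lip_const_def)
  have t0: "0 \<le> t" by (rule reach_nonneg[OF flight(1)])
  have le: "eps * t \<le> eps * (t + r)" using eps flight(2) by simp
  define \<xi> \<eta> where "\<xi> q = pX (flow q s) - Xb (eps * (t + q))"
    and "\<eta> q = W_smooth (flow q s) - Wb (eps * (t + q))" for q
  define f where "f q = exp (- L * (eps * (t + q))) * ((\<xi> q)\<^sup>2 + (\<eta> q)\<^sup>2) - c * eps\<^sup>2 * (eps * (t + q))" for q
  have "f r \<le> f 0"
  \<comment> \<open>The averaged equation and the margin are available only strictly inside the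
    interval, so monotonicity is taken from the open interval together with continuity.\<close>
  proof (rule DERIV_nonpos_imp_decreasing_open[OF flight(2)])
    fix q assume q: "0 < q" "q < r"
    define \<sigma> where "\<sigma> = eps * (t + q)"
    have \<sigma>: "0 < \<sigma>" using t0 q eps by (simp add: \<sigma>_def)
    have "\<sigma> < eps * (t + r)" using q eps by (simp add: \<sigma>_def)
    then have \<sigma>': "\<sigma> < \<tau>0" using flight.prems by linarith
    have rq: "rch (t + q) (flow q s)" using reach.flight[OF flight(1), of q] flight(3) q by auto
    let ?G = "((\<Sum>j\<in>UNIV. m1 j * (pv1 s j)\<^sup>2) - pV s * mom1 m1 (flow q s)) / pX (flow q s)
        + (pV s * mom2 m2 (flow q s) - (\<Sum>j\<in>UNIV. m2 j * (pv2 s j)\<^sup>2)) / (1 - pX (flow q s))"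
    define d\<xi> d\<eta> where "d\<xi> = pV s - Wb \<sigma> * eps"
      and "d\<eta> = eps * ?G - (F1 / Xb \<sigma> ^ 3 - F2 / (1 - Xb \<sigma>) ^ 3) * eps"
    have lin: "((\<lambda>q. eps * (t + q)) has_real_derivative eps) (at q)"
      by (auto intro!: derivative_eq_intros)
    have D\<xi>: "(\<xi> has_real_derivative d\<xi>) (at q)"
    proof -
      have "((\<lambda>q. pX (flow q s)) has_real_derivative pV s) (at q)"
        by (auto intro!: derivative_eq_intros)
      from DERIV_diff[OF this DERIV_chain2[OF dX[OF \<sigma> \<sigma>', unfolded \<sigma>_def] lin]]
      show ?thesis unfolding \<xi>_def[abs_def] d\<xi>_def \<sigma>_def .
    qed
    have D\<eta>: "(\<eta> has_real_derivative d\<eta>) (at q)"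
      using DERIV_diff[OF W_smooth_flow_deriv[OF flight(3)] DERIV_chain2[OF dW[OF \<sigma> \<sigma>', unfolded \<sigma>_def] lin]] q
      unfolding \<eta>_def[abs_def] d\<eta>_def \<sigma>_def by simp
    have b\<xi>: "\<bar>d\<xi> - eps * \<eta> q\<bar> \<le> eps * (eps * (mu * R))"
    proof -
      have "d\<xi> - eps * \<eta> q = eps * (pV (flow q s) / eps - W_smooth (flow q s))"
        using eps by (simp add: d\<xi>_def \<eta>_def \<sigma>_def algebra_simps)
      then show ?thesis
        using W_smooth_near[OF rq] eps by (simp only: abs_mult abs_of_pos mult_left_mono)
    qed
    have b\<eta>: "\<bar>d\<eta>\<bar> \<le> eps * (lip_const mu a R * \<bar>\<xi> q\<bar> + force_const mu a R T * eps)"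
    proof -
      have "\<bar>?G - (F1 / Xb \<sigma> ^ 3 - F2 / (1 - Xb \<sigma>) ^ 3)\<bar>
          \<le> lip_const mu a R * \<bar>pX (flow q s) - Xb \<sigma>\<bar> + force_const mu a R T * eps"
        using force_bound[OF rq _ rX[OF \<sigma> \<sigma>', THEN conjunct1] rX[OF \<sigma> \<sigma>', THEN conjunct2]] \<sigma>' T0
        by (simp only: flow_sel(2,4,6) \<sigma>_def)
      moreover have "d\<eta> = eps * (?G - (F1 / Xb \<sigma> ^ 3 - F2 / (1 - Xb \<sigma>) ^ 3))"
        by (simp only: d\<eta>_def right_diff_distrib mult.commute[of _ eps])
      ultimately show ?thesis
        using eps by (simp only: abs_mult abs_of_pos mult_left_mono \<xi>_def \<sigma>_def)
    qed
    let ?u = "(\<xi> q)\<^sup>2 + (\<eta> q)\<^sup>2" and ?e = "exp (- L * \<sigma>)"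
    have growth: "2 * \<xi> q * d\<xi> + 2 * \<eta> q * d\<eta> \<le> eps * (L * ?u + c * eps\<^sup>2)"
      using quadratic_growth[OF _ lip b\<xi> b\<eta>] eps by (simp add: L_def c_def)
    have Df: "(f has_real_derivative
        ?e * (2 * \<xi> q * d\<xi> + 2 * \<eta> q * d\<eta>) - L * eps * ?e * ?u - c * eps\<^sup>2 * eps) (at q)"
      unfolding f_def[abs_def] \<sigma>_def
      by (rule derivative_eq_intros D\<xi> D\<eta> refl)+ (simp add: algebra_simps)
    have L\<sigma>: "0 \<le> L * \<sigma>" using lip \<sigma> by (simp add: L_def)
    have "?e * (2 * \<xi> q * d\<xi> + 2 * \<eta> q * d\<eta>) \<le> ?e * (eps * (L * ?u + c * eps\<^sup>2))"
      using growth by (rule mult_left_mono) simp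
    also have "\<dots> = L * eps * ?e * ?u + ?e * (c * eps\<^sup>2 * eps)" by (simp add: algebra_simps)
    finally have up: "?e * (2 * \<xi> q * d\<xi> + 2 * \<eta> q * d\<eta>) \<le> L * eps * ?e * ?u + ?e * (c * eps\<^sup>2 * eps)" .
    \<comment> \<open>The exponential factor is at most 1 and is dropped from the source, which the
      linear term in the Lyapunov function then absorbs.\<close>
    have "?e * (c * eps\<^sup>2 * eps) \<le> 1 * (c * eps\<^sup>2 * eps)"
      using eps L\<sigma> by (intro mult_right_mono) (auto simp: c_def)
    with up have "?e * (2 * \<xi> q * d\<xi> + 2 * \<eta> q * d\<eta>) - L * eps * ?e * ?u - c * eps\<^sup>2 * eps \<le> 0"
      by linarith
    with Df show "\<exists>y. (f has_real_derivative y) (at q) \<and> y \<le> 0" by blast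
  next
    have img: "(\<lambda>q. eps * (t + q)) ` {0..r} \<subseteq> {0..\<tau>0}"
    proof (rule image_subsetI)
      fix q assume q: "q \<in> {0..r}"
      then have "eps * (t + q) \<le> eps * (t + r)" using eps by simp
      also have "\<dots> \<le> \<tau>0" by (rule flight.prems)
      finally have "eps * (t + q) \<le> \<tau>0" .
      then show "eps * (t + q) \<in> {0..\<tau>0}" using q t0 eps by auto
    qed
    have cl: "continuous_on {0..r} (\<lambda>q. eps * (t + q))" by (intro continuous_intros)
    have cP: "continuous_on {0..r} (\<lambda>q. W_smooth (flow q s))"
      using W_smooth_flow_deriv[OF flight(3)] by (intro DERIV_continuous_on) (auto intro: has_field_derivative_at_within)
    show "continuous_on {0..r} f"
      unfolding f_def[abs_def] \<xi>_def \<eta>_def flow_sel(1)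
      by (intro continuous_intros cP continuous_on_compose2[OF cX cl img] continuous_on_compose2[OF cW cl img])
  qed
  moreover have "f 0 \<le> (pX s0 - Xb 0)\<^sup>2 + (W_smooth s0 - Wb 0)\<^sup>2"
    using flight.IH flight.prems le by (simp add: f_def \<xi>_def \<eta>_def flow_def)
  ultimately show ?case by (simp add: f_def \<xi>_def \<eta>_def)
qed

text \<open>Smoothing costs \<open>eps * (mu * R)\<close> twice: as the initial velocity error,
  contained in \<open>err_const\<close>, and once more when returning to \<open>pV s / eps\<close>
  at the end.\<close>

lemma slow_motion_error:
  fixes Xb Wb :: "real \<Rightarrow> real"
  assumes cX: "continuous_on {0..\<tau>0} Xb" and cW: "continuous_on {0..\<tau>0} Wb"
    and dX: "\<And>\<sigma>. 0 < \<sigma> \<Longrightarrow> \<sigma> < \<tau>0 \<Longrightarrow> (Xb has_real_derivative Wb \<sigma>) (at \<sigma>)"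
    and dW: "\<And>\<sigma>. 0 < \<sigma> \<Longrightarrow> \<sigma> < \<tau>0 \<Longrightarrow>
      (Wb has_real_derivative F1 / Xb \<sigma> ^ 3 - F2 / (1 - Xb \<sigma>) ^ 3) (at \<sigma>)"
    and rX: "\<And>\<sigma>. 0 < \<sigma> \<Longrightarrow> \<sigma> < \<tau>0 \<Longrightarrow> a \<le> Xb \<sigma> \<and> Xb \<sigma> \<le> 1 - a"
    and T0: "\<tau>0 \<le> T"
    and s: "rch t s" and t: "eps * t = \<tau>0"
    and init: "Xb 0 = pX s0" "Wb 0 = pV s0 / eps"
  shows "\<bar>pX s - Xb \<tau>0\<bar> \<le> eps * sqrt (err_const mu a R T)"
    and "\<bar>pV s / eps - Wb \<tau>0\<bar> \<le> eps * (sqrt (err_const mu a R T) + mu * R)"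
proof -
  define L c where "L = 2 + lip_const mu a R" and "c = (mu * R)\<^sup>2 + (force_const mu a R T)\<^sup>2"
  let ?u = "(pX s - Xb \<tau>0)\<^sup>2 + (W_smooth s - Wb \<tau>0)\<^sup>2"
  have L: "0 \<le> L" using mu a by (simp add: lip_const_def L_def)
  have c: "0 \<le> c" by (simp add: c_def)
  have "\<bar>W_smooth s0 - Wb 0\<bar> \<le> eps * (mu * R)"
    using W_smooth_near[OF reach.start] by (simp add: init abs_minus_commute)
  then have "(W_smooth s0 - Wb 0)\<^sup>2 \<le> (eps * (mu * R))\<^sup>2" by (rule abs_le_square_iff[THEN iffD1, OF order_trans]) simp
  moreover have "exp (- L * \<tau>0) * ?u - c * eps\<^sup>2 * \<tau>0 \<le> (pX s0 - Xb 0)\<^sup>2 + (W_smooth s0 - Wb 0)\<^sup>2"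
    using gronwall_reach[OF cX cW dX dW rX T0 s] t unfolding L_def c_def by simp
  moreover have "c * eps\<^sup>2 * \<tau>0 \<le> c * eps\<^sup>2 * T" using c T0 by (intro mult_left_mono) auto
  ultimately have "exp (- L * \<tau>0) * ?u \<le> eps\<^sup>2 * ((mu * R)\<^sup>2 + c * T)"
    by (simp add: init algebra_simps power2_eq_square)
  then have "exp (L * \<tau>0) * (exp (- L * \<tau>0) * ?u) \<le> exp (L * T) * (eps\<^sup>2 * ((mu * R)\<^sup>2 + c * T))"
    by (rule mult_mono[rotated]) (use L T0 c T in \<open>auto intro: mult_left_mono\<close>)
  moreover have "exp (L * \<tau>0) * (exp (- L * \<tau>0) * ?u) = ?u"
    unfolding mult.assoc[symmetric] exp_add[symmetric] by simp
  moreover have "(eps * sqrt (err_const mu a R T))\<^sup>2 = exp (L * T) * (eps\<^sup>2 * ((mu * R)\<^sup>2 + c * T))"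
    using T by (simp add: err_const_def L_def c_def power_mult_distrib)
  ultimately have u: "?u \<le> (eps * sqrt (err_const mu a R T))\<^sup>2" by argo
  have err: "0 \<le> eps * sqrt (err_const mu a R T)" using eps T by (simp add: err_const_def)
  show 1: "\<bar>pX s - Xb \<tau>0\<bar> \<le> eps * sqrt (err_const mu a R T)"
    by (rule power2_le_imp_le[OF _ err]) (use u in \<open>simp add: sum_power2_ge_zero order_trans[OF _ u]\<close>)
  have "\<bar>W_smooth s - Wb \<tau>0\<bar> \<le> eps * sqrt (err_const mu a R T)"
    by (rule power2_le_imp_le[OF _ err]) (use u in \<open>simp add: sum_power2_ge_zero order_trans[OF _ u]\<close>)
  then show "\<bar>pV s / eps - Wb \<tau>0\<bar> \<le> eps * (sqrt (err_const mu a R T) + mu * R)"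
    using W_smooth_near[OF s] unfolding distrib_left by linarith
qed

end

section \<open>From motions to reachable states\<close>

text \<open>The margin is assumed only before \<open>ts\<close>, since the stopping time permits an
  exit at \<open>ts\<close> itself; continuity of the piston position carries it to the endpoint.
  The trace starts from \<open>\<gamma> 0\<close>, after the initial collisions.\<close>

lemma motion_reach:
  assumes mot: "is_motion m1 m2 M s0 S \<gamma>" and ts: "0 < ts" "ts \<le> S"
    and range: "\<And>r. 0 \<le> r \<Longrightarrow> r < ts \<Longrightarrow> a \<le> pX (\<gamma> r) \<and> pX (\<gamma> r) \<le> 1 - a"
  shows "safe a (\<gamma> 0)" and "reach m1 m2 M a (\<gamma> 0) ts (\<gamma> ts)"
proof -
  obtain k and t :: "nat \<Rightarrow> real" where t0: "t 0 = 0" and tk: "t k = S" and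
    lt: "\<And>i. i < k \<Longrightarrow> t i < t (Suc i)" and
    ph: "\<And>i \<tau>. i < k \<Longrightarrow> t i \<le> \<tau> \<Longrightarrow> \<tau> \<le> t (Suc i) \<Longrightarrow> in_phase (flow (\<tau> - t i) (\<gamma> (t i)))" and
    fl: "\<And>i \<tau>. i < k \<Longrightarrow> t i < \<tau> \<Longrightarrow> \<tau> < t (Suc i) \<Longrightarrow> \<gamma> \<tau> = flow (\<tau> - t i) (\<gamma> (t i))" and
    rs: "\<And>i. i < k \<Longrightarrow> resolve m1 m2 M (flow (t (Suc i) - t i) (\<gamma> (t i))) (\<gamma> (t (Suc i)))"
    using mot unfolding is_motion_def by blast
  have flow0: "flow 0 s = s" for s :: "('a, 'b) pstate" by (simp add: flow_def)
  have nonneg: "0 \<le> t i" if "i \<le> k" for i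
    using that
  proof (induction i)
    case (Suc i)
    then show ?case using lt[of i] by simp
  qed (simp add: t0)
  have safe_flight: "safe a (flow q (\<gamma> (t i)))"
    if i: "i < k" "t i < ts" and q: "0 \<le> q" "t i + q \<le> ts" "t i + q \<le> t (Suc i)" for i q
  proof -
    let ?r = "min ts (t (Suc i)) - t i"
    have r: "0 < ?r" "q \<in> {0..?r}" using i q lt[OF i(1)] by auto
    \<comment> \<open>\<open>\<gamma>\<close> is known to agree with the flight only strictly
      between collision times; the margin is obtained there and extended to both ends.\<close>
    have inner: "a \<le> pX (\<gamma> (t i)) + x * pV (\<gamma> (t i)) \<and> pX (\<gamma> (t i)) + x * pV (\<gamma> (t i)) \<le> 1 - a"
      if "x \<in> {0<..<?r}" for x
      using fl[OF i(1), of "t i + x"] range[of "t i + x"] nonneg[of i] i that by auto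
    have cont: "continuous_on {0..?r} (\<lambda>x. pX (\<gamma> (t i)) + x * pV (\<gamma> (t i)))"
      by (intro continuous_intros)
    have "a \<le> pX (\<gamma> (t i)) + q * pV (\<gamma> (t i))"
      by (rule continuous_ge_on_Ioo[OF cont _ r]) (use inner in blast)
    moreover have "a \<le> 1 - (pX (\<gamma> (t i)) + q * pV (\<gamma> (t i)))"
      by (rule continuous_ge_on_Ioo[OF continuous_on_diff[OF continuous_on_const cont] _ r])
        (use inner in fastforce)
    ultimately show ?thesis using ph[OF i(1), of "t i + q"] q by (simp add: safe_def)
  qed
  \<comment> \<open>The last flight is the one from \<open>t (n - 1)\<close>; it is cut off at
    \<open>ts\<close>.\<close>
  define n where "n = (LEAST n. ts \<le> t n)"
  have n: "ts \<le> t n" "n \<le> k"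
    unfolding n_def using ts tk by (auto intro: LeastI[of _ k] Least_le)
  have below: "t i < ts" if "i < n" for i
    using not_less_Least[of i "\<lambda>n. ts \<le> t n"] that by (simp add: n_def)
  have "n \<noteq> 0" using n(1) t0 ts(1) by (metis not_le)
  then obtain i where i: "n = Suc i" by (cases n) auto
  show safe0: "safe a (\<gamma> 0)"
    using safe_flight[of 0 0] lt[of 0] n i t0 ts flow0 by simp
  have rch: "reach m1 m2 M a (\<gamma> 0) (t l) (\<gamma> (t l))" if "l < n" for l
    using that
  proof (induction l)
    case 0
    then show ?case using t0 by (simp add: reach.start)
  next
    case (Suc l)
    have l: "l < k" "t l < ts" "t (Suc l) < ts" using Suc.prems n below by auto
    have "reach m1 m2 M a (\<gamma> 0) (t l + (t (Suc l) - t l)) (flow (t (Suc l) - t l) (\<gamma> (t l)))"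
      by (rule reach.flight) (use Suc lt[OF l(1)] safe_flight[OF l(1,2)] l in auto)
    then show ?case using reach_resolve[OF _ rs[OF l(1)]] by simp
  qed
  have ik: "i < k" "t i < ts" using i n below by auto
  have R: "reach m1 m2 M a (\<gamma> 0) (t i + (ts - t i)) (flow (ts - t i) (\<gamma> (t i)))"
    by (rule reach.flight) (use rch[of i] i ik n safe_flight[OF ik] in auto)
  show "reach m1 m2 M a (\<gamma> 0) ts (\<gamma> ts)"
  \<comment> \<open>At a collision time \<open>\<gamma> ts\<close> is the post-collision state, so
    the resolution has to be appended.\<close>
  proof (cases "ts = t (Suc i)")
    case True
    then show ?thesis using reach_resolve[OF _ rs[OF ik(1)]] R by simp
  next
    case False
    then show ?thesis using R fl[OF ik(1), of ts] ik i n by simp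
  qed
qed

section \<open>Conserved products of the averaged equation\<close>

text \<open>The derivative of speed times gap length vanishes by the product rule. Inserting these
  constants closes the equations for \<open>Xb\<close> and \<open>Wb\<close>, which no longer refer
  to the speeds.\<close>

lemma avg_solution_components:
  fixes hb :: "real \<Rightarrow> real \<times> real \<times> (real^'a::finite) \<times> (real^'b::finite)"
  defines "Xb \<equiv> \<lambda>\<sigma>. fst (hb \<sigma>)" and "Wb \<equiv> \<lambda>\<sigma>. fst (snd (hb \<sigma>))"
    and "s1 \<equiv> \<lambda>j \<sigma>. fst (snd (snd (hb \<sigma>))) $ j" and "s2 \<equiv> \<lambda>j \<sigma>. snd (snd (snd (hb \<sigma>))) $ j"
  assumes sol: "is_avg_solution m1 m2 h0 U hb" and \<tau>: "0 < \<tau>" "\<tau> \<le> U"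
    and range: "\<And>\<sigma>. 0 < \<sigma> \<Longrightarrow> \<sigma> < \<tau> \<Longrightarrow> 0 < Xb \<sigma> \<and> Xb \<sigma> < 1"
  shows "continuous_on {0..\<tau>} Xb" "continuous_on {0..\<tau>} Wb"
    "\<And>\<sigma>. 0 < \<sigma> \<Longrightarrow> \<sigma> < \<tau> \<Longrightarrow> (Xb has_real_derivative Wb \<sigma>) (at \<sigma>)"
    "\<And>\<sigma>. 0 < \<sigma> \<Longrightarrow> \<sigma> < \<tau> \<Longrightarrow> (Wb has_real_derivative
        (\<Sum>j\<in>UNIV. m1 j * (s1 j 0 * Xb 0)\<^sup>2) / Xb \<sigma> ^ 3 - (\<Sum>j\<in>UNIV. m2 j * (s2 j 0 * (1 - Xb 0))\<^sup>2) / (1 - Xb \<sigma>) ^ 3) (at \<sigma>)"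
    "\<And>\<sigma> j. 0 \<le> \<sigma> \<Longrightarrow> \<sigma> \<le> \<tau> \<Longrightarrow> s1 j \<sigma> * Xb \<sigma> = s1 j 0 * Xb 0"
    "\<And>\<sigma> j. 0 \<le> \<sigma> \<Longrightarrow> \<sigma> \<le> \<tau> \<Longrightarrow> s2 j \<sigma> * (1 - Xb \<sigma>) = s2 j 0 * (1 - Xb 0)"
proof -
  have d: "(hb has_vector_derivative Hbar m1 m2 (hb \<sigma>)) (at \<sigma> within {0..U})" if "\<sigma> \<in> {0..U}" for \<sigma>
    using sol that by (simp add: is_avg_solution_def)
  have "continuous_on {0..U} hb"
    by (rule continuous_on_vector_derivative) (rule d)
  then have c: "continuous_on {0..\<tau>} hb" by (rule continuous_on_subset) (use \<tau> in auto)
  show cX: "continuous_on {0..\<tau>} Xb" and cW: "continuous_on {0..\<tau>} Wb"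
    unfolding Xb_def Wb_def by (intro continuous_intros c)+
  have c1: "continuous_on {0..\<tau>} (s1 j)" for j
    unfolding s1_def by (intro continuous_intros c)
  have c2: "continuous_on {0..\<tau>} (s2 j)" for j
    unfolding s2_def by (intro continuous_intros c)
  have Heq: "Hbar m1 m2 (hb \<sigma>) = (Wb \<sigma>,
      (\<Sum>j\<in>UNIV. m1 j * (s1 j \<sigma>)\<^sup>2) / Xb \<sigma> - (\<Sum>j\<in>UNIV. m2 j * (s2 j \<sigma>)\<^sup>2) / (1 - Xb \<sigma>),
      (\<chi> j. - (s1 j \<sigma>) * Wb \<sigma> / Xb \<sigma>), (\<chi> j. s2 j \<sigma> * Wb \<sigma> / (1 - Xb \<sigma>)))" for \<sigma>
    by (simp add: Hbar_def case_prod_beta Xb_def Wb_def s1_def s2_def)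
  have D: "(hb has_vector_derivative Hbar m1 m2 (hb \<sigma>)) (at \<sigma>)" if "0 < \<sigma>" "\<sigma> < \<tau>" for \<sigma>
    using d[of \<sigma>] that \<tau> by (simp add: at_within_Icc_at)
  have comp: "((\<lambda>\<sigma>. f (hb \<sigma>)) has_real_derivative f (Hbar m1 m2 (hb \<sigma>))) (at \<sigma>)"
    if "bounded_linear f" "0 < \<sigma>" "\<sigma> < \<tau>" for f :: "_ \<Rightarrow> real" and \<sigma>
    unfolding has_real_derivative_iff_has_vector_derivative
    by (rule bounded_linear.has_vector_derivative[OF that(1) D[OF that(2,3)]])
  note bl = bounded_linear_fst bounded_linear_compose[OF bounded_linear_fst bounded_linear_snd]
  show dX: "(Xb has_real_derivative Wb \<sigma>) (at \<sigma>)" if "0 < \<sigma>" "\<sigma> < \<tau>" for \<sigma>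
    using comp[OF bl(1) that] unfolding Heq by (simp add: Xb_def)
  have dW: "(Wb has_real_derivative
      (\<Sum>j\<in>UNIV. m1 j * (s1 j \<sigma>)\<^sup>2) / Xb \<sigma> - (\<Sum>j\<in>UNIV. m2 j * (s2 j \<sigma>)\<^sup>2) / (1 - Xb \<sigma>)) (at \<sigma>)"
    if "0 < \<sigma>" "\<sigma> < \<tau>" for \<sigma>
    using comp[OF bl(2) that] unfolding Heq by (simp add: Wb_def)
  have d1: "(s1 j has_real_derivative - (s1 j \<sigma>) * Wb \<sigma> / Xb \<sigma>) (at \<sigma>)" if "0 < \<sigma>" "\<sigma> < \<tau>" for \<sigma> j
    using comp[OF bounded_linear_compose[OF bounded_linear_vec_nth[of j] bounded_linear_compose[OF bl(2) bounded_linear_snd]] that]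
    unfolding Heq by (simp add: s1_def)
  have d2: "(s2 j has_real_derivative s2 j \<sigma> * Wb \<sigma> / (1 - Xb \<sigma>)) (at \<sigma>)" if "0 < \<sigma>" "\<sigma> < \<tau>" for \<sigma> j
    using comp[OF bounded_linear_compose[OF bounded_linear_vec_nth[of j] bounded_linear_compose[OF bounded_linear_snd
        bounded_linear_compose[OF bounded_linear_snd bounded_linear_snd]]] that]
    unfolding Heq by (simp add: s2_def)
  show p1: "s1 j \<sigma> * Xb \<sigma> = s1 j 0 * Xb 0" if "0 \<le> \<sigma>" "\<sigma> \<le> \<tau>" for \<sigma> j
  proof (rule DERIV_isconst2[where f = "\<lambda>\<sigma>. s1 j \<sigma> * Xb \<sigma>", OF \<tau>(1) _ _ that])
    show "continuous_on {0..\<tau>} (\<lambda>\<sigma>. s1 j \<sigma> * Xb \<sigma>)" by (intro continuous_intros c1 cX)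
    fix x assume x: "0 < x" "x < \<tau>"
    show "((\<lambda>\<sigma>. s1 j \<sigma> * Xb \<sigma>) has_real_derivative 0) (at x)"
      using DERIV_mult[OF d1[OF x, of j] dX[OF x]] range[OF x] by simp
  qed
  show p2: "s2 j \<sigma> * (1 - Xb \<sigma>) = s2 j 0 * (1 - Xb 0)" if "0 \<le> \<sigma>" "\<sigma> \<le> \<tau>" for \<sigma> j
  proof (rule DERIV_isconst2[where f = "\<lambda>\<sigma>. s2 j \<sigma> * (1 - Xb \<sigma>)", OF \<tau>(1) _ _ that])
    show "continuous_on {0..\<tau>} (\<lambda>\<sigma>. s2 j \<sigma> * (1 - Xb \<sigma>))" by (intro continuous_intros c2 cX)
    fix x assume x: "0 < x" "x < \<tau>"
    show "((\<lambda>\<sigma>. s2 j \<sigma> * (1 - Xb \<sigma>)) has_real_derivative 0) (at x)"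
      using DERIV_mult[OF d2[OF x, of j] DERIV_diff[OF DERIV_const[of 1] dX[OF x]]] range[OF x] by simp
  qed
  have cube: "(\<Sum>j\<in>UNIV. m j * (s j)\<^sup>2) / x = (\<Sum>j\<in>UNIV. m j * (s j * x)\<^sup>2) / x ^ 3"
    if "0 < x" for m s :: "'i::finite \<Rightarrow> real" and x :: real
  proof -
    have "(\<Sum>j\<in>UNIV. m j * (s j * x)\<^sup>2) = (\<Sum>j\<in>UNIV. m j * (s j)\<^sup>2) * x\<^sup>2"
      by (simp add: sum_distrib_right power_mult_distrib mult.assoc)
    then show ?thesis using that by (simp add: power2_eq_square power3_eq_cube)
  qed
  show "(Wb has_real_derivative
        (\<Sum>j\<in>UNIV. m1 j * (s1 j 0 * Xb 0)\<^sup>2) / Xb \<sigma> ^ 3 - (\<Sum>j\<in>UNIV. m2 j * (s2 j 0 * (1 - Xb 0))\<^sup>2) / (1 - Xb \<sigma>) ^ 3) (at \<sigma>)"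
    if "0 < \<sigma>" "\<sigma> < \<tau>" for \<sigma>
    using dW[OF that] range[OF that] cube[of "Xb \<sigma>" m1 "\<lambda>j. s1 j \<sigma>"] cube[of "1 - Xb \<sigma>" m2 "\<lambda>j. s2 j \<sigma>"]
      p1[of \<sigma>] p2[of \<sigma>] that by simp
qed

section \<open>Total error of the slow variables\<close>

lemma norm_slow_le:
  fixes u v :: "real \<times> real \<times> (real^'a::finite) \<times> (real^'b::finite)"
  assumes "\<bar>fst u - fst v\<bar> \<le> c" "\<bar>fst (snd u) - fst (snd v)\<bar> \<le> d"
    and "\<And>j. \<bar>fst (snd (snd u)) $ j - fst (snd (snd v)) $ j\<bar> \<le> e"
    and "\<And>j. \<bar>snd (snd (snd u)) $ j - snd (snd (snd v)) $ j\<bar> \<le> e"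
  shows "norm (u - v) \<le> c + d + (real CARD('a) + real CARD('b)) * e"
proof -
  obtain a1 a2 a3 a4 b1 b2 b3 b4 where uv: "u = (a1, a2, a3, a4)" "v = (b1, b2, b3, b4)"
    by (metis surj_pair)
  have "norm (a3 - b3) \<le> (\<Sum>j\<in>UNIV. \<bar>(a3 - b3) $ j\<bar>)" by (rule norm_le_l1_cart)
  also have "\<dots> \<le> (\<Sum>j\<in>(UNIV::'a set). e)" using assms(3) by (intro sum_mono) (simp add: uv)
  finally have n3: "norm (a3 - b3) \<le> real CARD('a) * e" by simp
  have "norm (a4 - b4) \<le> (\<Sum>j\<in>UNIV. \<bar>(a4 - b4) $ j\<bar>)" by (rule norm_le_l1_cart)
  also have "\<dots> \<le> (\<Sum>j\<in>(UNIV::'b set). e)" using assms(4) by (intro sum_mono) (simp add: uv)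
  finally have n4: "norm (a4 - b4) \<le> real CARD('b) * e" by simp
  have "norm (u - v) \<le> norm (a1 - b1) + (norm (a2 - b2) + (norm (a3 - b3) + norm (a4 - b4)))"
    unfolding uv diff_Pair by (meson norm_Pair_le order_trans add_left_mono)
  then show ?thesis using n3 n4 assms(1,2) by (simp add: uv distrib_right)
qed

text \<open>The errors of \<open>X\<close>, of \<open>W\<close> and of the \<open>n\<close> gas
  speeds, added up.\<close>

definition total_const :: "real \<Rightarrow> real \<Rightarrow> real \<Rightarrow> real \<Rightarrow> real \<Rightarrow> real" where
  "total_const n mu a R T = sqrt (err_const mu a R T) + (sqrt (err_const mu a R T) + mu * R)
     + n * ((drift_const mu a R T + R * sqrt (err_const mu a R T)) / a)"

context piston_run
begin

lemma run_error:
  fixes hb :: "real \<Rightarrow> real \<times> real \<times> (real^'a::{finite,linorder}) \<times> (real^'b::{finite,linorder})"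
  assumes sol: "is_avg_solution m1 m2 (slow eps s0) U hb" and \<tau>: "0 < \<tau>" "\<tau> \<le> U" "\<tau> \<le> T"
    and range: "\<And>\<sigma>. 0 < \<sigma> \<Longrightarrow> \<sigma> < \<tau> \<Longrightarrow> a \<le> fst (hb \<sigma>) \<and> fst (hb \<sigma>) \<le> 1 - a"
    and s: "rch (\<tau> / eps) s"
  shows "norm (slow eps s - hb \<tau>) \<le> total_const (real CARD('a) + real CARD('b)) mu a R T * eps"
proof -
  define Xb Wb where "Xb \<sigma> = fst (hb \<sigma>)" and "Wb \<sigma> = fst (snd (hb \<sigma>))" for \<sigma>
  define s1 s2 where "s1 j \<sigma> = fst (snd (snd (hb \<sigma>))) $ j" and "s2 i \<sigma> = snd (snd (snd (hb \<sigma>))) $ i" for j i \<sigma>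
  have h0: "hb 0 = slow eps s0" using sol by (simp add: is_avg_solution_def)
  have init: "Xb 0 = pX s0" "Wb 0 = pV s0 / eps" "s1 j 0 = \<bar>pv1 s0 j\<bar>" "s2 i 0 = \<bar>pv2 s0 i\<bar>" for j i
    by (simp_all add: Xb_def Wb_def s1_def s2_def h0 slow_def)
  have rX: "a \<le> Xb \<sigma> \<and> Xb \<sigma> \<le> 1 - a" if "0 < \<sigma>" "\<sigma> < \<tau>" for \<sigma>
    using range[OF that] by (simp add: Xb_def)
  have rX': "0 < fst (hb \<sigma>) \<and> fst (hb \<sigma>) < 1" if "0 < \<sigma>" "\<sigma> < \<tau>" for \<sigma>
    using range[OF that] a by auto
  note C = avg_solution_components[OF sol \<tau>(1,2) rX', folded Xb_def Wb_def s1_def s2_def, unfolded init]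
  have t: "eps * (\<tau> / eps) = \<tau>" using eps by simp
  let ?r = "sqrt (err_const mu a R T)" and ?\<kappa> = "drift_const mu a R T"
  have E: "\<bar>pX s - Xb \<tau>\<bar> \<le> eps * ?r" "\<bar>pV s / eps - Wb \<tau>\<bar> \<le> eps * (?r + mu * R)"
    by (rule slow_motion_error[OF C(1,2,3,4) rX \<tau>(3) s t init(1,2)]; assumption)+
  \<comment> \<open>The division below needs the margin at \<open>\<tau>\<close> itself, which again
    comes from continuity.\<close>
  have Xt: "a \<le> Xb \<tau>" "a \<le> 1 - Xb \<tau>"
    by (rule continuous_ge_on_Ioo[OF C(1)] continuous_ge_on_Ioo[OF continuous_on_diff[OF continuous_on_const C(1)]];
        use rX \<tau> in fastforce)+
  \<comment> \<open>Nearly equal products with nearly equal gap lengths force nearly equal speeds,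
    because the averaged gap length is at least \<open>a\<close>.\<close>
  have quot: "\<bar>x - y\<bar> \<le> eps * ((?\<kappa> + R * ?r) / a)"
    if "\<bar>x * X - y * Y\<bar> \<le> eps * ?\<kappa>" "\<bar>x\<bar> \<le> R" "\<bar>X - Y\<bar> \<le> eps * ?r" "a \<le> Y" for x y X Y :: real
  proof -
    have "(x - y) * Y = (x * X - y * Y) - x * (X - Y)" by algebra
    moreover have "\<bar>x * (X - Y)\<bar> \<le> R * (eps * ?r)"
      unfolding abs_mult using that R by (intro mult_mono) auto
    ultimately have "\<bar>(x - y) * Y\<bar> \<le> eps * ?\<kappa> + R * (eps * ?r)" using that(1) by linarith
    moreover have "\<bar>x - y\<bar> * a \<le> \<bar>(x - y) * Y\<bar>"
      unfolding abs_mult using that(4) a by (intro mult_left_mono) auto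
    ultimately have "\<bar>x - y\<bar> * a \<le> eps * (?\<kappa> + R * ?r)" by (simp add: algebra_simps)
    then show ?thesis using a by (simp add: field_simps)
  qed
  have tT: "eps * (\<tau> / eps) \<le> T" using t \<tau> by simp
  have v1: "\<bar>\<bar>pv1 s j\<bar> - s1 j \<tau>\<bar> \<le> eps * ((?\<kappa> + R * ?r) / a)" for j
    using reach_adiabatic(1)[OF s tT, of j] C(5)[of \<tau> j] \<tau> reach_velocities(1)[OF s, of j] E(1) Xt(1)
    by (intro quot[of _ "pX s" _ "Xb \<tau>"]) auto
  have v2: "\<bar>\<bar>pv2 s i\<bar> - s2 i \<tau>\<bar> \<le> eps * ((?\<kappa> + R * ?r) / a)" for i
    using reach_adiabatic(2)[OF s tT, of i] C(6)[of \<tau> i] \<tau> reach_velocities(2)[OF s, of i] E(1) Xt(2)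
    by (intro quot[of _ "1 - pX s" _ "1 - Xb \<tau>"]) auto
  have "norm (slow eps s - hb \<tau>) \<le> eps * ?r + eps * (?r + mu * R)
      + (real CARD('a) + real CARD('b)) * (eps * ((?\<kappa> + R * ?r) / a))"
    using E v1 v2 by (intro norm_slow_le) (auto simp: slow_def Xb_def Wb_def s1_def s2_def)
  also have "\<dots> = total_const (real CARD('a) + real CARD('b)) mu a R T * eps"
    by (simp add: total_const_def distrib_right distrib_left mult.commute mult.left_commute)
  finally show ?thesis .
qed

end

section \<open>Uniform constants from compactness, and the theorem\<close>

lemma compact_subset_unit_interval:
  fixes A :: "real set"
  assumes "compact A" "A \<subseteq> {0<..<1}"
  obtains a where "0 < a" "A \<subseteq> {a..1 - a}"
proof (cases "A = {}")
  case True
  \<comment> \<open>Any positive value serves for the empty set.\<close>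
  then show ?thesis using that[of 1] by simp
next
  case False
  obtain l u where "l \<in> A" "\<And>x. x \<in> A \<Longrightarrow> l \<le> x" "u \<in> A" "\<And>x. x \<in> A \<Longrightarrow> x \<le> u"
    using compact_attains_inf[OF assms(1) False] compact_attains_sup[OF assms(1) False] by blast
  then show ?thesis using assms(2) by (intro that[of "min l (1 - u)"]) fastforce+
qed

text \<open>The bound is uniform in \<open>eps\<close>, because the piston term is exactly the
  square of the slow velocity.\<close>

lemma energy_slow_le:
  fixes s :: "('a::finite, 'b::finite) pstate"
  assumes m: "\<And>j. 0 < m1 j" "\<And>j. 0 < m2 j" and b: "norm (slow eps s) \<le> b"
  shows "energy m1 m2 (1 / eps\<^sup>2) s \<le> (sum m1 UNIV + sum m2 UNIV + 1) * b\<^sup>2"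
proof -
  have b1: "norm (pV s / eps, (\<chi> j. \<bar>pv1 s j\<bar>), (\<chi> j. \<bar>pv2 s j\<bar>)) \<le> b"
    using order_trans[OF norm_snd_le b[unfolded slow_def]] .
  have b2: "norm ((\<chi> j. \<bar>pv1 s j\<bar>), (\<chi> j. \<bar>pv2 s j\<bar>)) \<le> b"
    using order_trans[OF norm_snd_le b1] .
  have n: "\<bar>pV s / eps\<bar> \<le> b" "norm (\<chi> j. \<bar>pv1 s j\<bar>) \<le> b" "norm (\<chi> j. \<bar>pv2 s j\<bar>) \<le> b"
    using order_trans[OF norm_fst_le b1] order_trans[OF norm_fst_le b2] order_trans[OF norm_snd_le b2]
    by (simp_all only: real_norm_def)
  have v: "\<bar>pv1 s j\<bar> \<le> b" "\<bar>pv2 s i\<bar> \<le> b" for j i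
    using n(2,3) component_le_norm_cart[of "\<chi> j. \<bar>pv1 s j\<bar>" j] component_le_norm_cart[of "\<chi> j. \<bar>pv2 s j\<bar>" i] by auto
  have sq: "\<bar>x\<^sup>2\<bar> \<le> b\<^sup>2" if "\<bar>x\<bar> \<le> b" for x using power_mono[OF that, of 2] by simp
  have "\<bar>\<Sum>j\<in>UNIV. m1 j * (pv1 s j)\<^sup>2\<bar> \<le> sum m1 UNIV * b\<^sup>2" by (intro abs_mean_le m sq v)
  moreover have "\<bar>\<Sum>j\<in>UNIV. m2 j * (pv2 s j)\<^sup>2\<bar> \<le> sum m2 UNIV * b\<^sup>2" by (intro abs_mean_le m sq v)
  moreover have "1 / eps\<^sup>2 * (pV s)\<^sup>2 \<le> b\<^sup>2" using sq[OF n(1)] by (simp add: power_divide)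
  ultimately show ?thesis unfolding energy_def distrib_right by linarith
qed

lemma velocity_bound_exists:
  fixes m1 :: "'a::finite \<Rightarrow> real" and m2 :: "'b::finite \<Rightarrow> real"
  assumes m: "\<And>j. 0 < m1 j" "\<And>j. 0 < m2 j" and E: "0 \<le> E"
  obtains R where "0 < R" "E \<le> R\<^sup>2" "\<And>j. E \<le> m1 j * R\<^sup>2" "\<And>j. E \<le> m2 j * R\<^sup>2"
proof -
  \<comment> \<open>\<open>q\<close> is the square of the desired \<open>R\<close>. Summing all
    reciprocal masses handles all particles at once, and the leading 1 keeps \<open>q\<close>
    positive when \<open>E = 0\<close>.\<close>
  define q where "q = 1 + E * (1 + (\<Sum>j\<in>UNIV. 1 / m1 j) + (\<Sum>j\<in>UNIV. 1 / m2 j))"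
  have s: "0 \<le> (\<Sum>j\<in>UNIV. 1 / m1 j)" "0 \<le> (\<Sum>j\<in>UNIV. 1 / m2 j)"
    using m by (auto intro!: sum_nonneg simp: less_imp_le)
  have q: "E * c \<le> q" if "c \<le> 1 + (\<Sum>j\<in>UNIV. 1 / m1 j) + (\<Sum>j\<in>UNIV. 1 / m2 j)" for c
    using mult_left_mono[OF that E] by (simp add: q_def)
  have le1: "1 / m1 j \<le> (\<Sum>j\<in>UNIV. 1 / m1 j)" for j
    using m by (intro member_le_sum) (auto simp: less_imp_le)
  have le2: "1 / m2 j \<le> (\<Sum>j\<in>UNIV. 1 / m2 j)" for j
    using m by (intro member_le_sum) (auto simp: less_imp_le)
  have "0 < q" using q[of 0] E s by (simp add: q_def add_pos_nonneg)
  moreover have "E \<le> q" using q[of 1] s by simp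
  moreover have "E \<le> m1 j * q" for j
  proof -
    have "E * (1 / m1 j) \<le> q" by (rule q) (use le1[of j] s in linarith)
    then show ?thesis using m(1)[of j] by (simp add: pos_divide_le_eq mult.commute)
  qed
  moreover have "E \<le> m2 j * q" for j
  proof -
    have "E * (1 / m2 j) \<le> q" by (rule q) (use le2[of j] s in linarith)
    then show ?thesis using m(2)[of j] by (simp add: pos_divide_le_eq mult.commute)
  qed
  ultimately show ?thesis by (intro that[of "sqrt q"]) auto
qed

text \<open>Requiring membership in \<open>\<V>\<close> for every \<open>\<sigma> < \<tau>\<close>
  expresses that \<open>\<tau>\<close> does not exceed the stopping time, an infimum of exit times.
  The bounds by \<open>\<epsilon> * S\<close> and \<open>U\<close> keep \<open>\<tau>\<close> where
  the motion and the averaged solution are given.\<close>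

theorem theorem1:
  fixes m1 :: "'a::{finite,linorder} \<Rightarrow> real"
    and m2 :: "'b::{finite,linorder} \<Rightarrow> real"
    and \<V> :: "(real \<times> real \<times> (real^'a::{finite,linorder}) \<times> (real^'b::{finite,linorder})) set"
    and A B C :: "real set"
    and T :: real
  assumes m1_pos: "\<forall>j. m1 j > 0"
    and m2_pos: "\<forall>j. m2 j > 0"
    and V_compact: "compact \<V>"
    and A_compact: "compact A" and A_sub: "A \<subseteq> {0<..<1}"
    and B_compact: "compact B"
    and C_compact: "compact C" and C_sub: "C \<subseteq> {0<..}"
    and V_sub: "\<forall>(X, W, s1, s2) \<in> \<V>. X \<in> A \<and> W \<in> B \<and> (\<forall>j. s1 $ j \<in> C) \<and> (\<forall>j. s2 $ j \<in> C)"
    and T_pos: "T > 0"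
  shows "\<exists>K>0. \<exists>\<epsilon>0>0. \<forall>\<epsilon> s0 S \<gamma> U hb.
           0 < \<epsilon> \<and> \<epsilon> \<le> \<epsilon>0
           \<and> is_motion m1 m2 (1 / \<epsilon>^2) s0 S \<gamma>
           \<and> slow \<epsilon> (\<gamma> 0) \<in> \<V>
           \<and> is_avg_solution m1 m2 (slow \<epsilon> (\<gamma> 0)) U hb
           \<longrightarrow> (\<forall>\<tau>. 0 \<le> \<tau> \<and> \<tau> \<le> T \<and> \<tau> \<le> \<epsilon> * S \<and> \<tau> \<le> U
                   \<and> (\<forall>\<sigma>. 0 \<le> \<sigma> \<and> \<sigma> < \<tau> \<longrightarrow> hb \<sigma> \<in> \<V> \<and> slow \<epsilon> (\<gamma> (\<sigma> / \<epsilon>)) \<in> \<V>)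
                 \<longrightarrow> norm (slow \<epsilon> (\<gamma> (\<tau> / \<epsilon>)) - hb \<tau>) \<le> K * \<epsilon>)"
proof -
  have m: "\<And>j. 0 < m1 j" "\<And>j. 0 < m2 j" using m1_pos m2_pos by auto
  let ?mu = "sum m1 UNIV + sum m2 UNIV"
  obtain a where a: "0 < a" "A \<subseteq> {a..1 - a}"
    using compact_subset_unit_interval[OF A_compact A_sub] .
  have inV: "a \<le> fst h \<and> fst h \<le> 1 - a" if "h \<in> \<V>" for h
    using V_sub that a(2) by (cases h) fastforce
  obtain b where b: "\<And>h. h \<in> \<V> \<Longrightarrow> norm h \<le> b"
    using compact_imp_bounded[OF V_compact] unfolding bounded_iff by blast
  have "0 \<le> (?mu + 1) * b\<^sup>2" using m by (intro mult_nonneg_nonneg add_nonneg_nonneg sum_nonneg) (auto simp: less_imp_le)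
  then obtain R where R: "0 < R" "(?mu + 1) * b\<^sup>2 \<le> R\<^sup>2" "\<And>j. (?mu + 1) * b\<^sup>2 \<le> m1 j * R\<^sup>2"
    "\<And>j. (?mu + 1) * b\<^sup>2 \<le> m2 j * R\<^sup>2"
    using velocity_bound_exists[of m1 m2, OF m] by blast
  let ?K = "total_const (real CARD('a) + real CARD('b)) ?mu a R T"
  \<comment> \<open>The maximum with 1 makes the positivity of the constant immediate.\<close>
  have "norm (slow \<epsilon> (\<gamma> (\<tau> / \<epsilon>)) - hb \<tau>) \<le> max 1 ?K * \<epsilon>"
    if eps: "0 < \<epsilon>" "\<epsilon> \<le> 1" and mot: "is_motion m1 m2 (1 / \<epsilon>^2) s0 S \<gamma>"
      and init: "slow \<epsilon> (\<gamma> 0) \<in> \<V>" and sol: "is_avg_solution m1 m2 (slow \<epsilon> (\<gamma> 0)) U hb"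
      and \<tau>: "0 \<le> \<tau>" "\<tau> \<le> T" "\<tau> \<le> \<epsilon> * S" "\<tau> \<le> U"
      and stay: "\<And>\<sigma>. 0 \<le> \<sigma> \<Longrightarrow> \<sigma> < \<tau> \<Longrightarrow> hb \<sigma> \<in> \<V> \<and> slow \<epsilon> (\<gamma> (\<sigma> / \<epsilon>)) \<in> \<V>"
    for \<epsilon> s0 S \<gamma> U hb \<tau>
  proof (cases "\<tau> = 0")
    case True
    then show ?thesis using sol eps by (simp add: is_avg_solution_def)
  next
    case False
    then have \<tau>0: "0 < \<tau>" using \<tau> by simp
    have range: "a \<le> pX (\<gamma> r) \<and> pX (\<gamma> r) \<le> 1 - a" if "0 \<le> r" "r < \<tau> / \<epsilon>" for r
    proof -
      \<comment> \<open>The hypothesis lives in slow time, the margin in unscaled time.\<close>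
      have "slow \<epsilon> (\<gamma> (\<epsilon> * r / \<epsilon>)) \<in> \<V>"
        using stay[of "\<epsilon> * r"] that eps by (simp add: field_simps)
      then show ?thesis using inV eps by (fastforce simp: slow_def)
    qed
    have ts: "0 < \<tau> / \<epsilon>" "\<tau> / \<epsilon> \<le> S" using \<tau>0 \<tau> eps by (auto simp: field_simps)
    note mr = motion_reach[OF mot ts range]
    have en: "energy m1 m2 (1 / \<epsilon>\<^sup>2) (\<gamma> 0) \<le> (?mu + 1) * b\<^sup>2"
      by (rule energy_slow_le[OF m b[OF init]])
    interpret piston_run m1 m2 \<epsilon> a R T "\<gamma> 0"
      by unfold_locales (use m eps a R T_pos mr(1) order_trans[OF en] in auto)
    have "norm (slow \<epsilon> (\<gamma> (\<tau> / \<epsilon>)) - hb \<tau>) \<le> ?K * \<epsilon>"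
      using stay inV by (intro run_error[OF sol \<tau>0 \<tau>(4,2) _ mr(2)]) auto
    also have "\<dots> \<le> max 1 ?K * \<epsilon>" using eps by (intro mult_right_mono) auto
    finally show ?thesis .
  qed
  then show ?thesis by (intro exI[of _ "max 1 ?K"] exI[of _ 1] conjI) auto
qed

end
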